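(* Let $\mathcal{X}$ be a complex Banach space with Banach dual $\mathcal{X}'$, and let $\mathcal{T}:\mathbb{R}\to B(\mathcal{X})$ be a strongly continuous isometric representation such that its Beurling spectrum satisfies $\Lambda(\mathcal{X},\mathcal{T})\subseteq[-\gamma,\gamma]$ for some $\gamma>0$. For a vector $x\in\mathcal{X}$ and a set $\Gamma=\{\gamma_n:n\in\mathbb{Z}\}\subset\mathbb{R}$, let $X$ be the sequence $\{\mathcal{T}(\gamma_n)x\}_{n\in\mathbb{Z}}$. Assume that a sequence $Y=\{y_n\}_{n\in\mathbb{Z}}\subset\mathcal{X}'$ is such that the pair of sequences $(Y,X)$ forms an atomic decomposition for $\mathcal{X}$ with respect to $\ell^p(\mathbb{Z})$, for some $p\in[1,\infty)$, with bounds $B\ge A>0$. Additionally assume that the synthesis operator $T_X:\ell^p(\mathbb{Z})\to\mathcal{X}$ is bounded. Let $\widetilde\Gamma=\{\widetilde\gamma_n:n\in\mathbb{Z}\}\subset\mathbb{R}$ be such that $$\delta:=\sup\{|\widetilde\gamma_n-\gamma_n|:n\in\mathbb{Z}\}<\frac{\pi}{4\gamma}-\frac1\gamma\arcsin\left(\frac{1}{\sqrt2}\left(1-\frac{1}{B\|T_X\|}\right)\right).$$ Then there exists a sequence $Z\subset\mathcal{X}'$ such that the pair of sequences $(Z,W)$, where $W=\{\mathcal{T}(\widetilde\gamma_n)x\}_{n\in\mathbb{Z}}$, forms an atomic decomposition for $\mathcal{X}$ with respect to $\ell^p(\mathbb{Z})$ with bounds $$A\bigl(1+B\|T_X\|(1-\cos\delta\gamma+\sin\delta\gamma)\bigr)^{-1}\quad\text{and}\quad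 B\bigl(1-B\|T_X\|(1-\cos\delta\gamma+\sin\delta\gamma)\bigr)^{-1}.$$ Moreover, if $X$ is a basis then so is $W$.
   Context: $B(\mathcal{X})$ denotes the Banach algebra of bounded linear operators on $\mathcal{X}$. A representation $\mathcal{T}:\mathbb{R}\to B(\mathcal{X})$ satisfies $\mathcal{T}(0)=I$ and $\mathcal{T}(s+t)=\mathcal{T}(s)\mathcal{T}(t)$; it is isometric if every $\mathcal{T}(t)$ is an isometry, and strongly continuous if $t\mapsto\mathcal{T}(t)v$ is continuous for every $v\in\mathcal{X}$. For $f\in L^1(\mathbb{R})$ and $v\in\mathcal{X}$ put $fv=\int_{\mathbb{R}}f(t)\mathcal{T}(-t)v\,dt$ (Bochner integral), and let $\widehat f(\xi)=\int_{\mathbb{R}}f(t)e^{-it\xi}\,dt$. The Beurling spectrum is $$\Lambda(\mathcal{X},\mathcal{T})=\{\lambda\in\mathbb{R}:\ \text{if } f\in L^1(\mathbb{R}) \text{ and } fv=0 \text{ for all } v\in\mathcal{X},\text{ then } \widehat f(\lambda)=0\}.$$ A pair of sequences $(Y,X)$, $Y=\{y_n\}_{n\in\mathbb{Z}}\subset\mathcal{X}'$ and $X=\{x_n\}_{n\in\mathbb{Z}}\subset\mathcal{X}$, forms an atomic decomposition of (for) $\mathcal{X}$ with respect to $\ell^p(\mathbb{Z})$ with bounds $A$ and $B$ if: (1) $\{\langle v,y_n\rangle\}_{n}\in\ell^p(\mathbb{Z})$ for each $v\in\mathcal{X}$; (2) $A\|v\|\le\|\{\langle v,y_n\rangle\}_n\|_p\le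 B\|v\|$ for each $v\in\mathcal{X}$; (3) $v=\sum_{n\in\mathbb{Z}}\langle v,y_n\rangle x_n$ for each $v\in\mathcal{X}$. Here $\langle v,y\rangle$ is the value of the functional $y\in\mathcal{X}'$ at $v\in\mathcal{X}$. The synthesis operator of the atomic decomposition $(Y,X)$ is $T_Xc=\sum_{n\in\mathbb{Z}}c_nx_n$, $c=\{c_n\}\in\ell^p(\mathbb{Z})$; in general its domain is a subspace of $\ell^p(\mathbb{Z})$, and its boundedness from $\ell^p(\mathbb{Z})$ to $\mathcal{X}$ means that it is everywhere defined and bounded, with operator norm $\|T_X\|$. "Basis" means (Schauder) basis of $\mathcal{X}$. *)

theory Defs
  imports "HOL-Analysis.Analysis"
begin

section \<open>Complex Banach spaces\<close>

class complex_banach = banach +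
  fixes scaleC :: "complex \<Rightarrow> 'a \<Rightarrow> 'a"  (infixr "*\<^sub>C" 75)
  assumes scaleC_add_right: "c *\<^sub>C (x + y) = c *\<^sub>C x + c *\<^sub>C y"
    and scaleC_add_left: "(c + d) *\<^sub>C x = c *\<^sub>C x + d *\<^sub>C x"
    and scaleC_scaleC: "c *\<^sub>C (d *\<^sub>C x) = (c * d) *\<^sub>C x"
    and scaleC_of_real: "complex_of_real r *\<^sub>C x = r *\<^sub>R x"
    and norm_scaleC: "norm (c *\<^sub>C x) = cmod c * norm x"

instantiation complex :: complex_banach
begin

definition scaleC_complex :: "complex \<Rightarrow> complex \<Rightarrow> complex" where
  "scaleC_complex c z = c * z"

instance
  by standard (simp_all add: scaleC_complex_def algebra_simps norm_mult scaleR_conv_of_real)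

end

text \<open>For target \<open>complex\<close> these are the elements of the Banach dual; for target \<open>'a\<close> itself, the
  elements of the algebra of bounded operators.\<close>

definition bounded_clinear :: "('a::complex_banach \<Rightarrow> 'b::complex_banach) \<Rightarrow> bool" where
  "bounded_clinear f \<longleftrightarrow> bounded_linear f \<and> (\<forall>c x. f (c *\<^sub>C x) = c *\<^sub>C f x)"


section \<open>Representations of the real line and the Beurling spectrum\<close>

definition line_representation :: "(real \<Rightarrow> 'a::complex_banach \<Rightarrow> 'a) \<Rightarrow> bool" where
  "line_representation T \<longleftrightarrow>
     (\<forall>t. bounded_clinear (T t)) \<and> T 0 = id \<and> (\<forall>s t. T (s + t) = T s \<circ> T t)"

definition isometric :: "(real \<Rightarrow> 'a::complex_banach \<Rightarrow> 'a) \<Rightarrow> bool" where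
  "isometric T \<longleftrightarrow> (\<forall>t v. norm (T t v) = norm v)"

definition strongly_continuous :: "(real \<Rightarrow> 'a::complex_banach \<Rightarrow> 'a) \<Rightarrow> bool" where
  "strongly_continuous T \<longleftrightarrow> (\<forall>v. continuous_on UNIV (\<lambda>t. T t v))"

text \<open>The Bochner integral of the library is only available on second countable types. The
  following is the same definition without that sort constraint, so that it applies to arbitrary
  Banach spaces; the lemma after it records the agreement.\<close>

definition has_banach_integral :: "'m measure \<Rightarrow> ('m \<Rightarrow> 'a) \<Rightarrow> 'a::banach \<Rightarrow> bool" where
  "has_banach_integral M f w \<longleftrightarrow>
     f \<in> borel_measurable M \<and>
     (\<exists>s. (\<forall>i. Bochner_Integration.simple_bochner_integrable M (s i)) \<and>
          (\<lambda>i::nat. \<integral>\<^sup>+x. ennreal (norm (f x - s i x)) \<partial>M) \<longlonglongrightarrow> 0 \<and>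
          (\<lambda>i. Bochner_Integration.simple_bochner_integral M (s i)) \<longlonglongrightarrow> w)"

lemma has_banach_integral_iff_has_bochner_integral:
  fixes f :: "'m \<Rightarrow> 'a::{banach, second_countable_topology}"
  shows "has_banach_integral M f w \<longleftrightarrow> has_bochner_integral M f w"
  unfolding has_banach_integral_def has_bochner_integral.simps by blast

text \<open>\<open>L1_action T f v w\<close> says that \<open>f v = w\<close> for the action of \<open>L\<^sup>1\<close> on the space. For a strongly
  continuous isometric \<open>T\<close> and integrable \<open>f\<close> such a \<open>w\<close> exists and is unique.\<close>

definition L1_action ::
  "(real \<Rightarrow> 'a::complex_banach \<Rightarrow> 'a) \<Rightarrow> (real \<Rightarrow> complex) \<Rightarrow> 'a \<Rightarrow> 'a \<Rightarrow> bool" where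
  "L1_action T f v w \<longleftrightarrow> has_banach_integral lborel (\<lambda>t. f t *\<^sub>C T (- t) v) w"

definition fourier :: "(real \<Rightarrow> complex) \<Rightarrow> real \<Rightarrow> complex" where
  "fourier f \<xi> = (LINT t|lborel. f t * exp (- \<i> * complex_of_real (t * \<xi>)))"

text \<open>Every class in \<open>L\<^sup>1\<close> of the line has a Borel representative, and neither the action nor the
  Fourier transform depends on it, so it suffices to range over functions integrable with respect
  to \<open>lborel\<close>.\<close>

definition Beurling_spectrum :: "(real \<Rightarrow> 'a::complex_banach \<Rightarrow> 'a) \<Rightarrow> real set" where
  "Beurling_spectrum T =
     {\<xi>. \<forall>f. integrable lborel f \<and> (\<forall>v. L1_action T f v 0) \<longrightarrow> fourier f \<xi> = 0}"


section \<open>Sequence spaces and two-sided series\<close>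

definition lp :: "real \<Rightarrow> (int \<Rightarrow> complex) set" where
  "lp p = {c. (\<lambda>n. cmod (c n) powr p) summable_on UNIV}"

definition lp_norm :: "real \<Rightarrow> (int \<Rightarrow> complex) \<Rightarrow> real" where
  "lp_norm p c = (\<Sum>\<^sub>\<infinity>n. cmod (c n) powr p) powr (1 / p)"

text \<open>Convergence of a series indexed by the integers: both one-sided series converge. This is
  convergence of the sums over \<open>{-m..n}\<close> as \<open>m\<close> and \<open>n\<close> tend to infinity independently. It is not
  assumed to be unconditional, as suits Schauder bases.\<close>

definition int_sums :: "(int \<Rightarrow> 'a::real_normed_vector) \<Rightarrow> 'a \<Rightarrow> bool" where
  "int_sums f s \<longleftrightarrow>
     (\<exists>a b. (\<lambda>n. f (int n)) sums a \<and> (\<lambda>n. f (- int (Suc n))) sums b \<and> s = a + b)"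


section \<open>Atomic decompositions, synthesis operators and bases\<close>

definition atomic_decomposition ::
  "real \<Rightarrow> (int \<Rightarrow> 'a::complex_banach \<Rightarrow> complex) \<Rightarrow> (int \<Rightarrow> 'a) \<Rightarrow> real \<Rightarrow> real \<Rightarrow> bool" where
  "atomic_decomposition p Y X A B \<longleftrightarrow>
     (\<forall>n. bounded_clinear (Y n)) \<and>
     (\<forall>v. (\<lambda>n. Y n v) \<in> lp p) \<and>
     (\<forall>v. A * norm v \<le> lp_norm p (\<lambda>n. Y n v) \<and> lp_norm p (\<lambda>n. Y n v) \<le> B * norm v) \<and>
     (\<forall>v. int_sums (\<lambda>n. Y n v *\<^sub>C X n) v)"

text \<open>The value is meaningful only where the series converges.\<close>

definition synthesis :: "(int \<Rightarrow> 'a::complex_banach) \<Rightarrow> (int \<Rightarrow> complex) \<Rightarrow> 'a" where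
  "synthesis X c = (THE s. int_sums (\<lambda>n. c n *\<^sub>C X n) s)"

definition synthesis_bounded :: "real \<Rightarrow> (int \<Rightarrow> 'a::complex_banach) \<Rightarrow> bool" where
  "synthesis_bounded p X \<longleftrightarrow>
     (\<forall>c\<in>lp p. \<exists>s. int_sums (\<lambda>n. c n *\<^sub>C X n) s) \<and>
     (\<exists>K. \<forall>c\<in>lp p. norm (synthesis X c) \<le> K * lp_norm p c)"

definition synthesis_norm :: "real \<Rightarrow> (int \<Rightarrow> 'a::complex_banach) \<Rightarrow> real" where
  "synthesis_norm p X = (SUP c\<in>{c\<in>lp p. lp_norm p c \<le> 1}. norm (synthesis X c))"

definition schauder_basis :: "(int \<Rightarrow> 'a::complex_banach) \<Rightarrow> bool" where
  "schauder_basis X \<longleftrightarrow> (\<forall>v. \<exists>!c. int_sums (\<lambda>n. c n *\<^sub>C X n) v)"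

end

(* Kadec's expansion cis(dt) - 1 = Sum_j a_j(d) e_j(t) on |t| <= pi, with e_j half sums or half differences
   of two characters and Sum_j |a_j(d)| = 1 - cos(pi d) + sin(pi |d|), carries over to T(s) - I: for eta > gamma the
   expansion with t = pi lambda / eta holds for every orbit. To see this for the coefficients
   u(t) = Y_n(T(t)v), which separate points because (Y, X) is an atomic decomposition, let D be the
   defect of the expansion of u. Its means against Fejer kernels localised near a frequency xi vanish:
   for |xi| < eta because band-limited functions are superpositions of characters for which the
   expansion holds, and for |xi| > gamma by a Bernstein estimate and an f in L^1 annihilating u with
   nonzero Fourier transform at xi. Bisection of frequency intervals then gives D = 0.
   As |a_j| is monotone on [0, 1/4], the expansion bounds the norm of
   Sum c_n (T(g' n) - T(g n)) x by ||T_X|| (1 - cos(delta eta) + sin(delta eta)) ||c||_p; let eta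
   decrease to gamma. The hypothesis on delta makes v |-> Sum Y_n(v) T(g' n) x a perturbation of the
   identity of norm < 1; its inverse G gives Z_n = Y_n o G. *)
theory Submission
  imports Defs "HOL-Probability.Sinc_Integral"
begin

section \<open>Kadec's expansion\<close>

text \<open>The odd part of the expansion uses half-integer sines because \<open>sin (d t)\<close>
  does not vanish at pi, so its integer sine coefficients would decay only like 1/k. With cosines
  for the even part, all coefficients decay like 1/k^2. For d >= 0 the terms of each of the two
  series have one sign at t = pi, which is why the sum of absolute values has a closed form. The
  shifts d depend on n, whereas the synthesis operator controls only sums over n of multiples of the
  fixed vectors. So the sum over the expansion index goes outside: for each index the group law
  pulls one common translation out of the sum over n, where it is an isometry, and the factor
  depending on n is absorbed into the sequence c. Monotonicity bounds that factor by its value at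
  the supremum. At the frequencies \<gamma> and -\<gamma> there need be no annihilating f, and
  kernels centred there overlap larger frequencies. With \<eta> > \<gamma> the two frequency regions
  are open and cover the line, so local vanishing of means suffices. This analysis is done on scalar
  functions; the vector series converges by itself and the functionals only identify its
  sum.\<close>

lemma vanishes_if_orthogonal_cos_powers:
  fixes h :: "real \<Rightarrow> real"
  assumes h: "continuous_on {0..pi} h"
    and orth: "\<And>k. integral {0..pi} (\<lambda>t. h t * cos t ^ k) = 0"
    and t: "t \<in> {0..pi}"
  shows "h t = 0"
proof -
  \<comment> \<open>Under c = cos t the powers of \<open>cos t\<close> become monomials, so
    Weierstrass gives polynomials in \<open>cos t\<close> uniformly e-close to h. Orthogonality to
    them bounds the integral of h^2 by e times that of the absolute value of h, for every e.\<close>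
  define f where "f = (\<lambda>c. h (arccos c))"
  have f: "continuous_on {-1..1} f"
    unfolding f_def
    by (rule continuous_on_compose2[OF h]) (auto intro!: continuous_intros arccos_lbound arccos_ubound)
  have int: "(\<lambda>t. h t * g t) integrable_on {0..pi}" if "continuous_on {0..pi} g" for g
    by (intro integrable_continuous_real continuous_intros h that)
  define I where "I = integral {0..pi} (\<lambda>t. \<bar>h t\<bar>)"
  have le: "integral {0..pi} (\<lambda>t. h t * h t) \<le> e * I" if "e > 0" for e
  proof -
    obtain q where q: "real_polynomial_function q" "\<And>c. c \<in> {-1..1} \<Longrightarrow> \<bar>f c - q c\<bar> < e"
      using Stone_Weierstrass_real_polynomial_function[OF _ f \<open>e > 0\<close>] by auto
    then obtain a n where qa: "q = (\<lambda>x. \<Sum>i\<le>n. a i * x^i)"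
      by (auto simp: real_polynomial_function_iff_sum)
    have 0: "integral {0..pi} (\<lambda>t. h t * q (cos t)) = 0"
    proof -
      have "integral {0..pi} (\<lambda>t. h t * q (cos t))
          = integral {0..pi} (\<lambda>t. \<Sum>i\<le>n. a i * (h t * cos t ^ i))"
        by (simp add: qa sum_distrib_left mult_ac)
      also have "\<dots> = (\<Sum>i\<le>n. integral {0..pi} (\<lambda>t. a i * (h t * cos t ^ i)))"
        by (rule integral_sum) (auto intro!: integrable_continuous_real continuous_intros h)
      also have "\<dots> = 0"
        by (simp add: orth)
      finally show ?thesis .
    qed
    have cq: "continuous_on {0..pi} (\<lambda>t. q (cos t))"
      unfolding qa by (intro continuous_intros)
    have "integral {0..pi} (\<lambda>t. h t * h t)
        = integral {0..pi} (\<lambda>t. h t * h t) - integral {0..pi} (\<lambda>t. h t * q (cos t))"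
      using 0 by simp
    also have "\<dots> = integral {0..pi} (\<lambda>t. h t * h t - h t * q (cos t))"
      by (rule integral_diff[symmetric]) (intro int h cq)+
    also have "\<dots> \<le> integral {0..pi} (\<lambda>t. e * \<bar>h t\<bar>)"
    proof (rule integral_le)
      show "(\<lambda>t. h t * h t - h t * q (cos t)) integrable_on {0..pi}"
        by (intro integrable_diff int h cq)
      show "(\<lambda>t. e * \<bar>h t\<bar>) integrable_on {0..pi}"
        by (intro integrable_continuous_real continuous_intros h)
      fix s :: real assume s: "s \<in> {0..pi}"
      have "\<bar>h s - q (cos s)\<bar> \<le> e"
        using q(2)[of "cos s"] s by (auto simp: f_def arccos_cos)
      then have "\<bar>h s\<bar> * \<bar>h s - q (cos s)\<bar> \<le> \<bar>h s\<bar> * e"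
        by (intro mult_left_mono) auto
      moreover have "h s * (h s - q (cos s)) \<le> \<bar>h s\<bar> * \<bar>h s - q (cos s)\<bar>"
        by (metis abs_ge_self abs_mult)
      ultimately show "h s * h s - h s * q (cos s) \<le> e * \<bar>h s\<bar>"
        by (simp add: algebra_simps)
    qed
    also have "\<dots> = e * I"
      by (simp add: I_def)
    finally show ?thesis .
  qed
  have "((\<lambda>e. e * I) \<longlongrightarrow> 0 * I) (at_right 0)"
    by (intro tendsto_intros)
  then have "integral {0..pi} (\<lambda>t. h t * h t) \<le> 0"
    using le by (intro tendsto_lowerbound[where F="at_right 0"])
      (auto simp: eventually_at_right_less intro: eventually_mono[OF eventually_at_right_less])
  moreover have "integral {0..pi} (\<lambda>t. h t * h t) \<ge> 0"
    by (intro integral_nonneg int h) auto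
  ultimately have "integral {0..pi} (\<lambda>t. h t * h t) = 0"
    by simp
  then have "\<forall>t\<in>{0..pi}. h t * h t = 0"
    by (subst (asm) integral_eq_0_iff) (auto intro!: continuous_intros h)
  then show ?thesis
    using t by auto
qed

text \<open>By the recurrence, orthogonality of the defect to all \<open>F m\<close> gives orthogonality of defect times
  \<open>F m\<close> to all powers of \<open>cos\<close>. Applied to \<open>cos (m t)\<close> and to \<open>sin ((m + 1/2) t)\<close>.\<close>

lemma cosine_chain_expansion:
  fixes F :: "int \<Rightarrow> real \<Rightarrow> real" and f :: "real \<Rightarrow> real" and b :: "nat \<Rightarrow> real"
  assumes F: "\<And>m. continuous_on {0..pi} (F m)"
    and rec: "\<And>m t. 2 * cos t * F m t = F (m + 1) t + F (m - 1) t"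
    and bdd: "\<And>m t. \<bar>F m t\<bar> \<le> 1"
    and refl: "\<And>m. \<exists>k. F m = F (int k) \<or> F m = (\<lambda>t. - F (int k) t)"
    and orth: "\<And>j k. j \<noteq> k \<Longrightarrow> integral {0..pi} (\<lambda>t. F (int j) t * F (int k) t) = 0"
    and f: "continuous_on {0..pi} f"
    and b: "\<And>k. integral {0..pi} (\<lambda>t. f t * F (int k) t)
              = b k * integral {0..pi} (\<lambda>t. F (int k) t * F (int k) t)"
    and summ: "summable (\<lambda>k. \<bar>b k\<bar>)"
    and t: "t \<in> {0..pi}"
  shows "f t * F m t = (\<Sum>k. b k * F (int k) t) * F m t"
proof -
  have unif: "uniform_limit {0..pi} (\<lambda>n t. \<Sum>k<n. b k * F (int k) t)
      (\<lambda>t. \<Sum>k. b k * F (int k) t) sequentially"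
  proof (rule Weierstrass_m_test)
    show "norm (b k * F (int k) t) \<le> \<bar>b k\<bar>" for k t
      using mult_left_mono[OF bdd[of "int k" t], of "\<bar>b k\<bar>"] by (simp add: abs_mult)
  qed (rule summ)
  define S where "S = (\<lambda>t. \<Sum>k. b k * F (int k) t)"
  have cS: "continuous_on {0..pi} S"
    unfolding S_def
    by (rule uniform_limit_theorem[OF _ unif])
      (auto intro!: always_eventually continuous_intros F)
  define D where "D = (\<lambda>t. f t - S t)"
  have cD: "continuous_on {0..pi} D"
    unfolding D_def by (intro continuous_intros f cS)
  have intS: "integral {0..pi} (\<lambda>t. S t * F (int j) t)
      = b j * integral {0..pi} (\<lambda>t. F (int j) t * F (int j) t)" for j
  proof -
    have u: "uniform_limit {0..pi} (\<lambda>n t. (\<Sum>k<n. b k * F (int k) t) * F (int j) t)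
        (\<lambda>t. S t * F (int j) t) sequentially"
      unfolding S_def
    proof (rule uniform_lim_mult[OF unif uniform_limit_const])
      show "bounded ((\<lambda>t. \<Sum>k. b k * F (int k) t) ` {0..pi})"
        using compact_continuous_image[OF cS] compact_imp_bounded by (auto simp: S_def)
      show "bounded (F (int j) ` {0..pi})"
        using compact_continuous_image[OF F] compact_imp_bounded by auto
    qed
    obtain I J where IJ:
      "\<And>n. ((\<lambda>t. (\<Sum>k<n. b k * F (int k) t) * F (int j) t) has_integral I n) {0..pi}"
      "((\<lambda>t. S t * F (int j) t) has_integral J) {0..pi}" "I \<longlonglongrightarrow> J"
      by (rule uniform_limit_integral[OF u]) (auto intro!: continuous_intros F)
    have "I n = b j * integral {0..pi} (\<lambda>t. F (int j) t * F (int j) t)" if "n > j" for n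
    proof -
      have "I n = integral {0..pi} (\<lambda>t. \<Sum>k<n. b k * (F (int k) t * F (int j) t))"
        by (subst integral_unique[OF IJ(1)[of n], symmetric])
          (simp add: sum_distrib_right mult.assoc)
      also have "\<dots> = (\<Sum>k<n. integral {0..pi} (\<lambda>t. b k * (F (int k) t * F (int j) t)))"
        by (rule integral_sum) (auto intro!: integrable_continuous_real continuous_intros F)
      also have "\<dots> = (\<Sum>k<n. if k = j then b j * integral {0..pi} (\<lambda>t. F (int j) t * F (int j) t) else 0)"
        by (intro sum.cong) (auto simp: orth)
      also have "\<dots> = b j * integral {0..pi} (\<lambda>t. F (int j) t * F (int j) t)"
        using that by (simp add: sum.delta)
      finally show ?thesis .
    qed
    then have "I \<longlonglongrightarrow> b j * integral {0..pi} (\<lambda>t. F (int j) t * F (int j) t)"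
      by (intro tendsto_eventually) (auto simp: eventually_sequentially intro!: exI[of _ "Suc j"])
    then show ?thesis
      using IJ(2,3) LIMSEQ_unique integral_unique by blast
  qed
  have D0: "integral {0..pi} (\<lambda>t. D t * F (int j) t) = 0" for j
  proof -
    have "integral {0..pi} (\<lambda>t. D t * F (int j) t)
        = integral {0..pi} (\<lambda>t. f t * F (int j) t - S t * F (int j) t)"
      by (simp add: D_def algebra_simps)
    also have "\<dots> = integral {0..pi} (\<lambda>t. f t * F (int j) t) - integral {0..pi} (\<lambda>t. S t * F (int j) t)"
      by (rule integral_diff) (auto intro!: integrable_continuous_real continuous_intros F f cS)
    finally show ?thesis
      by (simp add: b intS)
  qed
  \<comment> \<open>The recurrence leads out of the natural indices; \<open>refl\<close> brings the
    negative ones back to the orthogonal family.\<close>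
  have D1: "integral {0..pi} (\<lambda>t. D t * F m t) = 0" for m
    using refl[of m] D0 by auto
  have D2: "integral {0..pi} (\<lambda>t. D t * cos t ^ k * F m t) = 0" for k m
  proof (induction k arbitrary: m)
    case (Suc k)
    have "integral {0..pi} (\<lambda>t. D t * cos t ^ Suc k * F m t)
        = integral {0..pi} (\<lambda>t. (D t * cos t ^ k * F (m + 1) t + D t * cos t ^ k * F (m - 1) t) / 2)"
    proof (rule integral_cong)
      fix t
      have "D t * cos t ^ Suc k * F m t = D t * cos t ^ k * (2 * cos t * F m t) / 2"
        by simp
      then show "D t * cos t ^ Suc k * F m t
          = (D t * cos t ^ k * F (m + 1) t + D t * cos t ^ k * F (m - 1) t) / 2"
        unfolding rec by (simp add: algebra_simps)
    qed
    also have "\<dots> = (integral {0..pi} (\<lambda>t. D t * cos t ^ k * F (m + 1) t)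
        + integral {0..pi} (\<lambda>t. D t * cos t ^ k * F (m - 1) t)) / 2"
      by (subst integral_divide, subst integral_add)
        (auto intro!: integrable_continuous_real continuous_intros F cD)
    finally show ?case
      by (simp add: Suc)
  qed (simp add: D1)
  \<comment> \<open>Only the product with \<open>F m\<close> is seen to vanish. The expansion itself
    follows where \<open>F m t\<close> is nonzero, which is why the conclusion keeps this
    factor.\<close>
  have "(\<lambda>t. D t * F m t) t = 0"
  proof (rule vanishes_if_orthogonal_cos_powers[OF _ _ t])
    show "continuous_on {0..pi} (\<lambda>t. D t * F m t)"
      by (intro continuous_intros F cD)
    show "integral {0..pi} (\<lambda>t. D t * F m t * cos t ^ k) = 0" for k
      using D2[of k m] by (simp add: mult_ac)
  qed
  then show ?thesis
    by (simp add: D_def S_def algebra_simps)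
qed

text \<open>Fourier cosine coefficients of \<open>cos (d t) - 1\<close> on [0, pi]. The k = 0 entry
  is the mean value of \<open>cos (d t)\<close> minus 1, and \<open>sinc\<close> keeps it meaningful
  at d = 0.\<close>

definition kadec_cos :: "real \<Rightarrow> nat \<Rightarrow> real" where
  "kadec_cos d k = (if k = 0 then sinc (pi * d) - 1
     else 2 / pi * (-1) ^ k * sin (pi * d) * d / (d\<^sup>2 - (real k)\<^sup>2))"

text \<open>Coefficients of \<open>sin (d t)\<close> in the orthogonal system
  \<open>sin ((k + 1/2) t)\<close> on [0, pi]. These sines are symmetric about pi, so the reflected
  function has no jump there and the coefficients decay like 1/k^2.\<close>

definition kadec_sin :: "real \<Rightarrow> nat \<Rightarrow> real" where
  "kadec_sin d k = 2 / pi * (-1) ^ k * cos (pi * d) * d / ((real k + 1/2)\<^sup>2 - d\<^sup>2)"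

section \<open>Trigonometric integrals and decay of the coefficients\<close>

lemma has_integral_cos_mult:
  assumes "a \<noteq> 0"
  shows "((\<lambda>t. cos (a * t)) has_integral sin (a * pi) / a) {0..pi}"
proof -
  have "((\<lambda>t. cos (a * t)) has_integral sin (a * pi) / a - sin (a * 0) / a) {0..pi}"
    using assms
    by (intro fundamental_theorem_of_calculus)
      (auto intro!: derivative_eq_intros simp: has_real_derivative_iff_has_vector_derivative[symmetric])
  then show ?thesis by simp
qed

lemma has_integral_cos_cos:
  assumes "a \<noteq> b" "a \<noteq> - b"
  shows "((\<lambda>t. cos (a * t) * cos (b * t)) has_integral
     (sin ((a - b) * pi) / (a - b) + sin ((a + b) * pi) / (a + b)) / 2) {0..pi}"
proof -
  have "((\<lambda>t. (cos ((a - b) * t) + cos ((a + b) * t)) / 2) has_integral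
     (sin ((a - b) * pi) / (a - b) + sin ((a + b) * pi) / (a + b)) / 2) {0..pi}"
    using assms by (intro has_integral_divide has_integral_add has_integral_cos_mult) auto
  then show ?thesis
    by (simp add: cos_times_cos algebra_simps)
qed

lemma has_integral_sin_sin:
  assumes "a \<noteq> b" "a \<noteq> - b"
  shows "((\<lambda>t. sin (a * t) * sin (b * t)) has_integral
     (sin ((a - b) * pi) / (a - b) - sin ((a + b) * pi) / (a + b)) / 2) {0..pi}"
proof -
  have "((\<lambda>t. (cos ((a - b) * t) - cos ((a + b) * t)) / 2) has_integral
     (sin ((a - b) * pi) / (a - b) - sin ((a + b) * pi) / (a + b)) / 2) {0..pi}"
    using assms by (intro has_integral_divide has_integral_diff has_integral_cos_mult) auto
  then show ?thesis
    by (simp add: sin_times_sin algebra_simps)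
qed

lemma has_integral_cos_sq:
  assumes "sin (2 * a * pi) = 0" "a \<noteq> 0"
  shows "((\<lambda>t. cos (a * t) * cos (a * t)) has_integral pi / 2) {0..pi}"
    and "((\<lambda>t. sin (a * t) * sin (a * t)) has_integral pi / 2) {0..pi}"
proof -
  have c: "((\<lambda>t. 1) has_integral pi) {0..pi}"
    using has_integral_const_real[of "1::real" 0 pi] by simp
  have "((\<lambda>t. (1 + cos (2 * a * t)) / 2) has_integral (pi + sin (2 * a * pi) / (2 * a)) / 2) {0..pi}"
    using assms by (intro has_integral_divide has_integral_add has_integral_cos_mult c) auto
  moreover have "(1 + cos (2 * a * t)) / 2 = cos (a * t) * cos (a * t)" for t
    using cos_times_cos[of "a * t" "a * t"] by (simp add: algebra_simps)
  ultimately show "((\<lambda>t. cos (a * t) * cos (a * t)) has_integral pi / 2) {0..pi}"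
    using assms by simp
  have "((\<lambda>t. (1 - cos (2 * a * t)) / 2) has_integral (pi - sin (2 * a * pi) / (2 * a)) / 2) {0..pi}"
    using assms by (intro has_integral_divide has_integral_diff has_integral_cos_mult c) auto
  moreover have "(1 - cos (2 * a * t)) / 2 = sin (a * t) * sin (a * t)" for t
    using sin_times_sin[of "a * t" "a * t"] by (simp add: algebra_simps)
  ultimately show "((\<lambda>t. sin (a * t) * sin (a * t)) has_integral pi / 2) {0..pi}"
    using assms by simp
qed

lemma sin_nat_shift_pi:
  "sin ((x + real n) * pi) = (-1) ^ n * sin (x * pi)" "sin ((x - real n) * pi) = (-1) ^ n * sin (x * pi)"
  by (simp_all add: algebra_simps sin_add sin_diff)

lemma sin_half_nat_shift_pi:
  "sin ((x + (real n + 1/2)) * pi) = (-1) ^ n * cos (x * pi)"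
  "sin ((x - (real n + 1/2)) * pi) = - ((-1) ^ n * cos (x * pi))"
proof -
  have "(x + (real n + 1/2)) * pi = (x + real n) * pi + pi / 2"
    "(x - (real n + 1/2)) * pi = (x - real n) * pi - pi / 2"
    by (simp_all add: algebra_simps)
  moreover have "cos ((x + real n) * pi) = (-1) ^ n * cos (x * pi)"
    "cos ((x - real n) * pi) = (-1) ^ n * cos (x * pi)"
    by (simp_all add: algebra_simps cos_add cos_diff)
  ultimately show "sin ((x + (real n + 1/2)) * pi) = (-1) ^ n * cos (x * pi)"
    "sin ((x - (real n + 1/2)) * pi) = - ((-1) ^ n * cos (x * pi))"
    by (simp_all add: sin_add sin_diff)
qed

text \<open>Only the order 1/k^2 matters. As d^2 <= 1/16, the denominator is at least an eighth of
  \<open>(real (Suc k))\<^sup>2\<close>. The same majorant serves \<open>kadec_sin\<close>, whose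
  tightest case k = 0 is 1/4 - 1/16 >= 1/8.\<close>

lemma kadec_cos_bound:
  assumes "0 \<le> d" "d \<le> 1/4"
  shows "\<bar>kadec_cos d (Suc k)\<bar> \<le> 8 * inverse (real (Suc k) ^ 2)"
proof -
  have d2: "d\<^sup>2 \<le> 1/16"
    using power_mono[OF assms(2,1), of 2] by (simp add: power_divide)
  have "1 \<le> (real (Suc k))\<^sup>2"
    by (rule one_le_power) simp
  then have 1: "(real (Suc k))\<^sup>2 - d\<^sup>2 \<ge> (real (Suc k))\<^sup>2 / 8"
    using d2 by linarith
  then have 2: "(real (Suc k))\<^sup>2 - d\<^sup>2 > 0"
    by (rule less_le_trans[rotated]) simp
  have "\<bar>kadec_cos d (Suc k)\<bar> = 2 / pi * \<bar>sin (pi * d)\<bar> * d / ((real (Suc k))\<^sup>2 - d\<^sup>2)"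
    using 2 assms by (simp add: kadec_cos_def abs_mult power_abs abs_minus_commute del: of_nat_Suc)
  also have "\<dots> \<le> 1 * 1 * 1 / ((real (Suc k))\<^sup>2 / 8)"
    using 1 2 assms pi_ge_two by (intro frac_le mult_mono) auto
  finally show ?thesis by (simp add: field_simps)
qed

lemma kadec_sin_bound:
  assumes "0 \<le> d" "d \<le> 1/4"
  shows "\<bar>kadec_sin d k\<bar> \<le> 8 * inverse (real (Suc k) ^ 2)"
proof -
  have d2: "d\<^sup>2 \<le> 1/16"
    using power_mono[OF assms(2,1), of 2] by (simp add: power_divide)
  have 1: "(real k + 1/2)\<^sup>2 - d\<^sup>2 \<ge> (real (Suc k))\<^sup>2 / 8"
  proof -
    have "(real k + 1/2)\<^sup>2 = (real k)\<^sup>2 + real k + 1/4" "(real (Suc k))\<^sup>2 = (real k)\<^sup>2 + 2 * real k + 1"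
      by (simp_all add: power2_eq_square algebra_simps)
    then show ?thesis
      using d2 zero_le_power2[of "real k"] of_nat_0_le_iff[of k, where 'a=real] by linarith
  qed
  then have 2: "(real k + 1/2)\<^sup>2 - d\<^sup>2 > 0"
    by (rule less_le_trans[rotated]) simp
  have "\<bar>kadec_sin d k\<bar> = 2 / pi * \<bar>cos (pi * d)\<bar> * d / ((real k + 1/2)\<^sup>2 - d\<^sup>2)"
    using 2 assms by (simp add: kadec_sin_def abs_mult power_abs)
  also have "\<dots> \<le> 1 * 1 * 1 / ((real (Suc k))\<^sup>2 / 8)"
    using 1 2 assms pi_ge_two by (intro frac_le mult_mono) auto
  finally show ?thesis by (simp add: field_simps)
qed

lemma summable_kadec:
  assumes "0 \<le> d" "d \<le> 1/4"
  shows "summable (\<lambda>k. \<bar>kadec_cos d k\<bar>)" "summable (\<lambda>k. \<bar>kadec_sin d k\<bar>)"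
proof -
  have s: "summable (\<lambda>k. 8 * inverse (real (Suc k) ^ 2))"
    using inverse_power_summable[of 2, where 'a=real]
    by (intro summable_mult) (subst summable_Suc_iff, auto)
  have "summable (\<lambda>k. \<bar>kadec_cos d (Suc k)\<bar>)"
    by (rule summable_comparison_test'[OF s]) (use kadec_cos_bound[OF assms] in auto)
  then show "summable (\<lambda>k. \<bar>kadec_cos d k\<bar>)"
    by (subst (asm) summable_Suc_iff)
  show "summable (\<lambda>k. \<bar>kadec_sin d k\<bar>)"
    by (rule summable_comparison_test'[OF s]) (use kadec_sin_bound[OF assms] in auto)
qed

lemma sinc_le_1: "sinc x \<le> 1"
  using abs_sin_x_le_abs_x[of x] by (auto simp: divide_le_eq)

lemma kadec_cos_expansion_pos:
  assumes d: "0 < d" "d \<le> 1/4" and t: "t \<in> {0..pi}"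
  shows "(\<lambda>k. kadec_cos d k * cos (real k * t)) sums (cos (d * t) - 1)"
proof -
  \<comment> \<open>These are the coefficients of \<open>cos (d t)\<close> itself; the 1 added at k
    = 0 is taken off again by \<open>sums_single\<close> at the end.\<close>
  define b where "b k = kadec_cos d k + (if k = 0 then 1 else 0)" for k
  define F where "F m t = cos (real_of_int m * t)" for m t
  have ne: "d \<noteq> real k" "d \<noteq> - real k" if "k > 0" for k
    using d that by auto
  have ne': "d + real k \<noteq> 0" "d - real k \<noteq> 0" if "k > 0" for k
    using ne[OF that] by auto
  have orth0: "integral {0..pi} (\<lambda>t. F (int j) t * F (int k) t) = 0" if "j \<noteq> k" for j k
  proof -
    have "((\<lambda>t. cos (real j * t) * cos (real k * t)) has_integral
       (sin ((real j - real k) * pi) / (real j - real k) + sin ((real j + real k) * pi) / (real j + real k)) / 2) {0..pi}"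
      using that by (intro has_integral_cos_cos) auto
    moreover have "sin ((real j - real k) * pi) = 0" "sin ((real j + real k) * pi) = 0"
      by (simp_all add: left_diff_distrib distrib_right sin_diff sin_add)
    ultimately show ?thesis
      by (simp add: F_def integral_unique)
  qed
  have sb: "summable (\<lambda>k. \<bar>b k\<bar>)"
  proof -
    have "summable (\<lambda>k. \<bar>b (Suc k)\<bar>)"
      using summable_kadec(1)[of d] d summable_Suc_iff[of "\<lambda>k. \<bar>kadec_cos d k\<bar>"] by (simp add: b_def)
    then show ?thesis by (subst (asm) summable_Suc_iff)
  qed
  have "cos (d * t) * F 0 t = (\<Sum>k. b k * F (int k) t) * F 0 t"
  proof (rule cosine_chain_expansion[where F=F and f="\<lambda>t. cos (d * t)"])
    show "continuous_on {0..pi} (F m)" for m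
      unfolding F_def by (intro continuous_intros)
    show "2 * cos t * F m t = F (m + 1) t + F (m - 1) t" for m t
      by (simp add: F_def algebra_simps cos_add cos_diff)
    show "\<exists>k. F m = F (int k) \<or> F m = (\<lambda>t. - F (int k) t)" for m
    proof -
      have "F m = F (int (nat \<bar>m\<bar>))"
        by (cases "m \<ge> 0") (auto simp: F_def fun_eq_iff)
      then show ?thesis by blast
    qed
    show "integral {0..pi} (\<lambda>t. cos (d * t) * F (int k) t)
        = b k * integral {0..pi} (\<lambda>t. F (int k) t * F (int k) t)" for k
    proof (cases "k = 0")
      case True
      then show ?thesis
        using has_integral_cos_mult[of d] d
        by (simp add: F_def b_def kadec_cos_def integral_unique mult_ac)
    next
      case False
      have 1: "integral {0..pi} (\<lambda>t. F (int k) t * F (int k) t) = pi / 2"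
        using has_integral_cos_sq(1)[of "real k"] False sin_npi[of "2 * k"]
        by (simp add: F_def integral_unique mult_ac)
      have "integral {0..pi} (\<lambda>t. cos (d * t) * F (int k) t)
         = (sin ((d - real k) * pi) / (d - real k) + sin ((d + real k) * pi) / (d + real k)) / 2"
        unfolding F_def using has_integral_cos_cos[OF ne[of k]] False by (simp add: integral_unique)
      also have "\<dots> = (-1) ^ k * sin (d * pi) * d / (d\<^sup>2 - (real k)\<^sup>2)"
        unfolding sin_nat_shift_pi power2_eq_square square_diff_square_factored
        using ne'[of k] False by (simp add: divide_simps) (simp add: algebra_simps)
      finally show ?thesis
        using False unfolding 1 by (simp add: b_def kadec_cos_def mult_ac)
    qed
  qed (use orth0 sb t in \<open>auto simp: F_def intro!: continuous_intros\<close>)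
  then have *: "cos (d * t) = (\<Sum>k. b k * cos (real k * t))"
    by (simp add: F_def)
  have "summable (\<lambda>k. b k * cos (real k * t))"
  proof (rule summable_comparison_test'[OF sb])
    show "norm (b k * cos (real k * t)) \<le> \<bar>b k\<bar>" for k
      using mult_left_mono[OF abs_cos_le_one[of "real k * t"], of "\<bar>b k\<bar>"] by (simp add: abs_mult)
  qed
  then have "(\<lambda>k. b k * cos (real k * t)) sums cos (d * t)"
    unfolding * by (rule summable_sums)
  from sums_diff[OF this sums_single[of 0 "\<lambda>_. 1"]] show ?thesis
    by (rule sums_cong[THEN iffD1, rotated]) (auto simp: b_def)
qed

lemma kadec_sin_expansion_pos:
  assumes d: "0 < d" "d \<le> 1/4" and t: "t \<in> {0..pi}"
  shows "(\<lambda>k. kadec_sin d k * sin ((real k + 1/2) * t)) sums sin (d * t)"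
\<comment> \<open>The chain yields the expansion times \<open>F 0 t\<close>, which is sin (t / 2)
  and has t = 0 as its only zero in [0, pi].\<close>
proof (cases "t = 0")
  case False
  define F where "F m t = sin ((real_of_int m + 1/2) * t)" for m t
  have ne: "d \<noteq> real k + 1/2" "d \<noteq> - (real k + 1/2)" for k
    using d by auto
  have ne': "d + (real k + 1/2) \<noteq> 0" "d - (real k + 1/2) \<noteq> 0" for k
    using ne[of k] by auto
  have orth0: "integral {0..pi} (\<lambda>t. F (int j) t * F (int k) t) = 0" if "j \<noteq> k" for j k
  proof -
    have "((\<lambda>t. sin ((real j + 1/2) * t) * sin ((real k + 1/2) * t)) has_integral
       (sin (((real j + 1/2) - (real k + 1/2)) * pi) / ((real j + 1/2) - (real k + 1/2))
        - sin (((real j + 1/2) + (real k + 1/2)) * pi) / ((real j + 1/2) + (real k + 1/2))) / 2) {0..pi}"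
      using that by (intro has_integral_sin_sin) auto
    moreover have "sin (((real j + 1/2) - (real k + 1/2)) * pi) = 0"
      "sin (((real j + 1/2) + (real k + 1/2)) * pi) = 0"
    proof -
      have e: "((real j + 1/2) - (real k + 1/2)) * pi = real j * pi - real k * pi"
        "((real j + 1/2) + (real k + 1/2)) * pi = real (j + k + 1) * pi"
        by (simp_all add: algebra_simps)
      show "sin (((real j + 1/2) - (real k + 1/2)) * pi) = 0"
        unfolding e(1) by (simp add: sin_diff)
      show "sin (((real j + 1/2) + (real k + 1/2)) * pi) = 0"
        unfolding e(2) by (rule sin_npi)
    qed
    ultimately show ?thesis
      by (simp add: F_def integral_unique)
  qed
  have sb: "summable (\<lambda>k. \<bar>kadec_sin d k\<bar>)"
    using d by (intro summable_kadec) auto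
  have "sin (d * t) * F 0 t = (\<Sum>k. kadec_sin d k * F (int k) t) * F 0 t"
  proof (rule cosine_chain_expansion[where F=F and f="\<lambda>t. sin (d * t)"])
    show "continuous_on {0..pi} (F m)" for m
      unfolding F_def by (intro continuous_intros)
    show "2 * cos t * F m t = F (m + 1) t + F (m - 1) t" for m t
    proof -
      have "(real_of_int (m + 1) + 1/2) * t = (real_of_int m + 1/2) * t + t"
        "(real_of_int (m - 1) + 1/2) * t = (real_of_int m + 1/2) * t - t"
        by (simp_all add: algebra_simps)
      then show ?thesis
        unfolding F_def by (simp only: sin_add sin_diff) (simp add: algebra_simps)
    qed
    show "\<exists>k. F m = F (int k) \<or> F m = (\<lambda>t. - F (int k) t)" for m
    proof (cases "m \<ge> 0")
      case True
      then have "F m = F (int (nat m))" by simp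
      then show ?thesis by blast
    next
      case False
      \<comment> \<open>The reflection of m to -m - 1 sends m + 1/2 to its negative.\<close>
      have "F m t = - F (int (nat (- m - 1))) t" for t
      proof -
        have "(real_of_int m + 1/2) * t = - ((real_of_int (int (nat (- m - 1))) + 1/2) * t)"
          using False by (simp add: algebra_simps)
        then show ?thesis
          unfolding F_def by (simp only: sin_minus)
      qed
      then show ?thesis by blast
    qed
    show "integral {0..pi} (\<lambda>t. sin (d * t) * F (int k) t)
        = kadec_sin d k * integral {0..pi} (\<lambda>t. F (int k) t * F (int k) t)" for k
    proof -
      have "sin (2 * (real k + 1/2) * pi) = 0"
        using sin_npi[of "2 * k + 1"] by (simp add: algebra_simps)
      then have 1: "integral {0..pi} (\<lambda>t. F (int k) t * F (int k) t) = pi / 2"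
        using has_integral_cos_sq(2)[of "real k + 1/2"]
        by (simp add: F_def integral_unique)
      have "integral {0..pi} (\<lambda>t. sin (d * t) * F (int k) t)
         = (sin ((d - (real k + 1/2)) * pi) / (d - (real k + 1/2)) - sin ((d + (real k + 1/2)) * pi) / (d + (real k + 1/2))) / 2"
        unfolding F_def using has_integral_sin_sin[OF ne[of k]] by (simp add: integral_unique)
      also have "\<dots> = (-1) ^ k * cos (d * pi) * d / ((real k + 1/2)\<^sup>2 - d\<^sup>2)"
      proof -
        define m where "m = real k + 1/2"
        have "d - m \<noteq> 0" "d + m \<noteq> 0" "m - d \<noteq> 0" "m + d \<noteq> 0"
          using ne'[of k] by (auto simp: m_def)
        then show ?thesis
          unfolding sin_half_nat_shift_pi m_def power2_eq_square square_diff_square_factored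
          unfolding m_def[symmetric]
          by (simp add: divide_simps) (simp add: algebra_simps)
      qed
      finally show ?thesis
        unfolding 1 by (simp add: kadec_sin_def mult_ac)
    qed
  qed (use orth0 sb t in \<open>auto simp: F_def intro!: continuous_intros\<close>)
  moreover have "F 0 t \<noteq> 0"
    using sin_gt_zero[of "t/2"] t False by (auto simp: F_def)
  ultimately have *: "sin (d * t) = (\<Sum>k. kadec_sin d k * sin ((real k + 1/2) * t))"
    by (simp add: F_def)
  have "summable (\<lambda>k. kadec_sin d k * sin ((real k + 1/2) * t))"
  proof (rule summable_comparison_test'[OF sb])
    show "norm (kadec_sin d k * sin ((real k + 1/2) * t)) \<le> \<bar>kadec_sin d k\<bar>" for k
      using mult_left_mono[OF abs_sin_le_one[of "(real k + 1/2) * t"], of "\<bar>kadec_sin d k\<bar>"]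
      by (simp add: abs_mult)
  qed
  then show ?thesis
    unfolding * by (rule summable_sums)
qed simp

lemma kadec_cos_minus [simp]: "kadec_cos (- d) k = kadec_cos d k"
  by (simp add: kadec_cos_def)

lemma kadec_sin_minus [simp]: "kadec_sin (- d) k = - kadec_sin d k"
  by (simp add: kadec_sin_def)

lemma kadec_0 [simp]: "kadec_cos 0 k = 0" "kadec_sin 0 k = 0"
  by (simp_all add: kadec_cos_def kadec_sin_def)

lemma kadec_abs: "\<bar>kadec_cos \<bar>d\<bar> k\<bar> = \<bar>kadec_cos d k\<bar>" "\<bar>kadec_sin \<bar>d\<bar> k\<bar> = \<bar>kadec_sin d k\<bar>"
  by (auto simp: abs_if)

lemma kadec_cos_expansion:
  assumes d: "\<bar>d\<bar> \<le> 1/4" and t: "\<bar>t\<bar> \<le> pi"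
  shows "(\<lambda>k. kadec_cos d k * cos (real k * t)) sums (cos (d * t) - 1)"
proof -
  have *: "(\<lambda>k. kadec_cos \<bar>d\<bar> k * cos (real k * \<bar>t\<bar>)) sums (cos (\<bar>d\<bar> * \<bar>t\<bar>) - 1)"
    using kadec_cos_expansion_pos[of "\<bar>d\<bar>" "\<bar>t\<bar>"] assms by (cases "d = 0") auto
  have "kadec_cos \<bar>d\<bar> k = kadec_cos d k" for k
    by (auto simp: abs_if)
  moreover have "cos (real k * \<bar>t\<bar>) = cos (real k * t)" for k
    by (auto simp: abs_if)
  moreover have "cos (\<bar>d\<bar> * \<bar>t\<bar>) = cos (d * t)"
    by (auto simp: abs_if)
  ultimately show ?thesis
    using * by simp
qed

lemma kadec_sin_expansion:
  assumes d: "\<bar>d\<bar> \<le> 1/4" and t: "\<bar>t\<bar> \<le> pi"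
  shows "(\<lambda>k. kadec_sin d k * sin ((real k + 1/2) * t)) sums sin (d * t)"
proof -
  have *: "(\<lambda>k. kadec_sin \<bar>d\<bar> k * sin ((real k + 1/2) * \<bar>t\<bar>)) sums (sin (\<bar>d\<bar> * \<bar>t\<bar>))"
    using kadec_sin_expansion_pos[of "\<bar>d\<bar>" "\<bar>t\<bar>"] assms by (cases "d = 0") auto
  \<comment> \<open>Every term and the sum are odd in d and in t, so both signs factor out
    together.\<close>
  define e where "e = (sgn d * sgn t :: real)"
  show ?thesis
  proof (cases "d = 0 \<or> t = 0")
    case False
    have "kadec_sin \<bar>d\<bar> k * sin ((real k + 1/2) * \<bar>t\<bar>) = e * (kadec_sin d k * sin ((real k + 1/2) * t))" for k
      using False by (auto simp: e_def abs_if)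
    moreover have "sin (\<bar>d\<bar> * \<bar>t\<bar>) = e * sin (d * t)"
      using False by (auto simp: e_def abs_if)
    ultimately have "(\<lambda>k. e * (kadec_sin d k * sin ((real k + 1/2) * t))) sums (e * sin (d * t))"
      using * by simp
    then show ?thesis
      using False by (subst (asm) sums_mult_iff) (auto simp: e_def sgn_eq_0_iff)
  qed auto
qed

text \<open>At t = pi the alternating signs of the coefficients cancel against
  \<open>cos (k pi)\<close> and \<open>sin ((k + 1/2) pi)\<close>: for d >= 0 every term is minus
  its absolute value in the cosine series and plus its absolute value in the sine series. So the sum
  is read off from the two expansions at pi.\<close>

lemma sums_kadec_abs:
  assumes d: "\<bar>d\<bar> \<le> 1/4"
  shows "(\<lambda>k. \<bar>kadec_cos d k\<bar> + \<bar>kadec_sin d k\<bar>) sums (1 - cos (pi * d) + sin (pi * \<bar>d\<bar>))"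
proof -
  define c where "c = \<bar>d\<bar>"
  have c: "0 \<le> c" "c \<le> 1/4" using d by (auto simp: c_def)
  have pc: "0 \<le> pi * c" "pi * c \<le> pi / 4"
    using c by auto
  have sc: "sin (pi * c) \<ge> 0" "cos (pi * c) \<ge> 0"
    using pc pi_gt_zero by (auto intro!: sin_ge_zero cos_ge_zero simp del: pi_gt_zero)
  have c2: "c\<^sup>2 \<le> 1/16"
    using power_mono[OF c(2,1), of 2] by (simp add: power_divide)
  have 1: "- (kadec_cos c k * cos (real k * pi)) = \<bar>kadec_cos c k\<bar>" for k
  proof (cases "k = 0")
    case True
    then show ?thesis using sinc_le_1[of "pi * c"] by (simp add: kadec_cos_def)
  next
    case False
    then have "1 \<le> (real k)\<^sup>2"
      by (intro one_le_power) simp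
    then have "c\<^sup>2 - (real k)\<^sup>2 < 0"
      using c2 by linarith
    then show ?thesis
      using False sc c
      by (cases "even k") (simp_all add: kadec_cos_def abs_mult divide_simps, simp_all add: algebra_simps)
  qed
  have 2: "kadec_sin c k * sin ((real k + 1/2) * pi) = \<bar>kadec_sin c k\<bar>" for k
  proof -
    have "(real k + 1/2)\<^sup>2 \<ge> (1/2)\<^sup>2" by (intro power_mono) auto
    then have "(real k + 1/2)\<^sup>2 - c\<^sup>2 > 0"
      using c2 by (simp add: power_divide)
    then show ?thesis
      using sc c sin_half_nat_shift_pi(1)[of 0 k]
      by (simp add: kadec_sin_def abs_mult power_abs flip: power_mult_distrib)
  qed
  have "(\<lambda>k. \<bar>kadec_cos c k\<bar> + \<bar>kadec_sin c k\<bar>) sums (- (cos (c * pi) - 1) + sin (c * pi))"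
    unfolding 1[symmetric] 2[symmetric] using c
    by (intro sums_add sums_minus kadec_cos_expansion kadec_sin_expansion) auto
  moreover have "cos (c * pi) = cos (pi * d)"
    by (simp add: c_def abs_if mult.commute)
  ultimately show ?thesis
    by (simp add: c_def kadec_abs mult.commute)
qed

text \<open>Apart from \<open>kadec_cos\<close> at k = 0, the absolute values are quotients whose
  numerators increase and whose denominators decrease in the modulus of the shift. At k = 0 the
  value is 1 - sinc, and sinc decreases on the range in question.\<close>

lemma kadec_abs_mono:
  assumes "\<bar>c\<bar> \<le> d" "d \<le> 1/4"
  shows "\<bar>kadec_cos c k\<bar> \<le> \<bar>kadec_cos d k\<bar>" "\<bar>kadec_sin c k\<bar> \<le> \<bar>kadec_sin d k\<bar>"
proof -
  define a where "a = \<bar>c\<bar>"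
  have a: "0 \<le> a" "a \<le> d" "a \<le> 1/4" "0 \<le> d" using assms by (auto simp: a_def)
  \<comment> \<open>The derivative \<open>cos x - x * sin x\<close> is nonnegative up to pi/4,
    because there x <= 1 and sin x <= cos x.\<close>
  have mono: "(\<lambda>x. x * cos x) a' \<le> (\<lambda>x. x * cos x) b'" if "0 \<le> a'" "a' \<le> b'" "b' \<le> pi / 4" for a' b' :: real
  proof (rule DERIV_nonneg_imp_nondecreasing[where f="\<lambda>x. x * cos x", OF that(2)])
    fix x assume x: "a' \<le> x" "x \<le> b'"
    then have x': "0 \<le> x" "x \<le> pi / 4" using that by auto
    have "x * sin x \<le> 1 * sin x"
      using x' pi_less_4 sin_ge_zero[of x] by (intro mult_right_mono) auto
    also have "\<dots> = cos (pi / 2 - x)"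
      by (simp add: cos_diff)
    also have "cos (pi / 2 - x) \<le> cos x"
      using x' by (intro cos_monotone_0_pi_le) auto
    finally have "0 \<le> cos x - x * sin x" by linarith
    then show "\<exists>y. ((\<lambda>x. x * cos x) has_real_derivative y) (at x) \<and> 0 \<le> y"
      by (intro exI[of _ "cos x - x * sin x"]) (auto intro!: derivative_eq_intros)
  qed
  have sq: "a\<^sup>2 \<le> d\<^sup>2" using a by (intro power_mono)
  have d2: "d\<^sup>2 \<le> 1/16"
    using power_mono[OF assms(2), of 2] a by (simp add: power_divide)
  have pa: "0 \<le> pi * a" "pi * a \<le> pi * d" "pi * d \<le> pi / 4"
    using a assms by auto
  have pb: "- (pi / 2) \<le> pi * a" "- (pi / 2) \<le> pi * d" "pi * a \<le> pi / 2" "pi * d \<le> pi / 2" "pi * a \<le> pi"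
    using pa pi_gt_zero by linarith+
  have sins: "0 \<le> sin (pi * a)" "sin (pi * a) \<le> sin (pi * d)"
    by (intro sin_ge_zero sin_monotone_2pi_le pa pb)+
  have coss: "0 \<le> cos (pi * a)" "0 \<le> cos (pi * d)"
    by (intro cos_ge_zero pb)+
  show "\<bar>kadec_cos c k\<bar> \<le> \<bar>kadec_cos d k\<bar>"
  proof (cases "k = 0")
    case True
    have "sinc (pi * d) \<le> sinc (pi * a)"
    proof (cases "a = 0")
      case True
      then show ?thesis using sinc_le_1[of "pi * d"] by simp
    next
      case False
      have "(\<lambda>x. sin x / x) (pi * d) \<le> (\<lambda>x. sin x / x) (pi * a)"
      proof (rule DERIV_nonpos_imp_nonincreasing[where f="\<lambda>x. sin x / x", OF pa(2)])
        fix x assume x: "pi * a \<le> x" "x \<le> pi * d"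
        have "0 < pi * a" using False a by simp
        then have x': "0 < x" "x \<le> pi / 4" using pa x by linarith+
        \<comment> \<open>This is the numerator of the derivative of sin x / x; it starts from 0 and
          has derivative - (y sin y).\<close>
        have "(\<lambda>x. x * cos x - sin x) x \<le> (\<lambda>x. x * cos x - sin x) 0"
        proof (rule DERIV_nonpos_imp_nonincreasing[where f="\<lambda>x. x * cos x - sin x"])
          fix y assume y: "0 \<le> y" "y \<le> x"
          then have "y * sin y \<ge> 0"
            using x' by (intro mult_nonneg_nonneg sin_ge_zero) auto
          then show "\<exists>z. ((\<lambda>x. x * cos x - sin x) has_real_derivative z) (at y) \<and> z \<le> 0"
            by (intro exI[of _ "- (y * sin y)"]) (auto intro!: derivative_eq_intros)
        qed (use x' in auto)
        then show "\<exists>y. ((\<lambda>x. sin x / x) has_real_derivative y) (at x) \<and> y \<le> 0"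
          using x' by (intro exI[of _ "(x * cos x - sin x) / x\<^sup>2"])
            (auto intro!: derivative_eq_intros simp: field_simps power2_eq_square divide_nonpos_nonneg)
      qed
      then show ?thesis using False a by auto
    qed
    then have "\<bar>kadec_cos a k\<bar> \<le> \<bar>kadec_cos d k\<bar>"
      using True sinc_le_1[of "pi * d"] sinc_le_1[of "pi * a"] by (simp add: kadec_cos_def)
    then show ?thesis by (simp add: a_def kadec_abs)
  next
    case False
    then have "1 \<le> (real k)\<^sup>2"
      by (intro one_le_power) simp
    then have k: "(real k)\<^sup>2 - d\<^sup>2 > 0"
      using d2 by linarith
    have ka: "(real k)\<^sup>2 - a\<^sup>2 > 0"
      using k sq by linarith
    have form: "\<bar>kadec_cos x k\<bar> = 2 / pi * sin (pi * x) * x / ((real k)\<^sup>2 - x\<^sup>2)"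
      if "sin (pi * x) \<ge> 0" "x \<ge> 0" "(real k)\<^sup>2 - x\<^sup>2 > 0" for x
      using that False by (auto simp: kadec_cos_def abs_mult power_abs abs_minus_commute[of "x\<^sup>2"])
    have "\<bar>kadec_cos a k\<bar> = 2 / pi * sin (pi * a) * a / ((real k)\<^sup>2 - a\<^sup>2)"
      by (intro form sins a ka)
    also have "\<dots> \<le> 2 / pi * sin (pi * d) * d / ((real k)\<^sup>2 - d\<^sup>2)"
      using sins a k sq by (intro frac_le mult_mono mult_nonneg_nonneg) auto
    also have "\<dots> = \<bar>kadec_cos d k\<bar>"
      using sins a k by (intro form[symmetric]) auto
    finally show ?thesis by (simp add: a_def kadec_abs)
  qed
  have "(real k + 1/2)\<^sup>2 \<ge> (1/2)\<^sup>2" by (intro power_mono) auto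
  then have k: "(real k + 1/2)\<^sup>2 - d\<^sup>2 > 0"
    using d2 by (simp add: power_divide)
  have ka: "(real k + 1/2)\<^sup>2 - a\<^sup>2 > 0"
    using k sq by linarith
  have form: "\<bar>kadec_sin x k\<bar> = 2 / pi\<^sup>2 * ((pi * x) * cos (pi * x)) / ((real k + 1/2)\<^sup>2 - x\<^sup>2)"
    if "cos (pi * x) \<ge> 0" "x \<ge> 0" "(real k + 1/2)\<^sup>2 - x\<^sup>2 > 0" for x
    using that by (simp add: kadec_sin_def abs_mult power_abs power2_eq_square)
  have "\<bar>kadec_sin a k\<bar> = 2 / pi\<^sup>2 * ((pi * a) * cos (pi * a)) / ((real k + 1/2)\<^sup>2 - a\<^sup>2)"
    by (intro form coss a ka)
  also have "\<dots> \<le> 2 / pi\<^sup>2 * ((pi * d) * cos (pi * d)) / ((real k + 1/2)\<^sup>2 - d\<^sup>2)"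
    using coss a k sq mono[of "pi * a" "pi * d"] pa by (intro frac_le mult_left_mono mult_nonneg_nonneg) auto
  also have "\<dots> = \<bar>kadec_sin d k\<bar>"
    using coss a k by (intro form[symmetric]) auto
  finally show "\<bar>kadec_sin c k\<bar> \<le> \<bar>kadec_sin d k\<bar>" by (simp add: a_def kadec_abs)
qed

section \<open>Band-limited functions\<close>

text \<open>On a character \<open>cis (l * x)\<close> the half sum and the half difference act as
  multiplication by cos (k t) and i sin ((k + 1/2) t), where t = l h. With the step h = pi / \<eta>,
  frequencies |l| <= \<eta> correspond to |t| <= pi, the range of Kadec's expansion.\<close>

definition kadec_term :: "real \<Rightarrow> real \<Rightarrow> (real \<Rightarrow> 'v::real_normed_vector) \<Rightarrow> real \<Rightarrow> nat \<Rightarrow> 'v" where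
  "kadec_term d h U x k =
     (kadec_cos d k / 2) *\<^sub>R (U (x + real k * h) + U (x - real k * h)) +
     (kadec_sin d k / 2) *\<^sub>R (U (x + (real k + 1/2) * h) - U (x - (real k + 1/2) * h))"

text \<open>With d = s \<eta> / pi one has d t = l s, so the expansion of
  \<open>cis (d t) - 1\<close> represents translation by s minus the identity, and the restriction
  on s reads |d| <= 1/4. The predicate stands in for a bound \<eta> on the frequencies of U and
  passes to multiples, sums, translates and integrals.\<close>

definition kadec_expands :: "real \<Rightarrow> (real \<Rightarrow> 'v::real_normed_vector) \<Rightarrow> bool" where
  "kadec_expands \<eta> U \<longleftrightarrow>
     (\<forall>x s. \<bar>s\<bar> * \<eta> \<le> pi / 4 \<longrightarrow> kadec_term (s * \<eta> / pi) (pi / \<eta>) U x sums (U (x + s) - U x))"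

section \<open>Bounds for the expansion and its stability\<close>

lemma norm_kadec_term_le:
  assumes "\<And>y. norm (U y) \<le> C"
  shows "norm (kadec_term d h U x k) \<le> (\<bar>kadec_cos d k\<bar> + \<bar>kadec_sin d k\<bar>) * C"
proof -
  have 1: "norm (U a + U b) \<le> 2 * C" "norm (U a - U b) \<le> 2 * C" for a b
    using norm_triangle_ineq[of "U a" "U b"] norm_triangle_ineq4[of "U a" "U b"] assms[of a] assms[of b]
    by linarith+
  have "norm (kadec_term d h U x k) \<le> \<bar>kadec_cos d k / 2\<bar> * (2 * C) + \<bar>kadec_sin d k / 2\<bar> * (2 * C)"
    unfolding kadec_term_def
    by (rule order_trans[OF norm_triangle_ineq])
      (unfold norm_scaleR, intro add_mono mult_left_mono 1 abs_ge_zero)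
  then show ?thesis
    by (simp add: algebra_simps)
qed

text \<open>A bound through the four translates survives integration over a parameter when the
  integrals of the translates are uniformly bounded but no integrable pointwise majorant is at
  hand.\<close>

lemma norm_kadec_term_le_sum:
  fixes U :: "real \<Rightarrow> 'v::real_normed_vector"
  shows "norm (kadec_term d h U x k) \<le> (\<bar>kadec_cos d k\<bar> + \<bar>kadec_sin d k\<bar>) / 2 *
     (norm (U (x + real k * h)) + norm (U (x - real k * h)) +
      norm (U (x + (real k + 1/2) * h)) + norm (U (x - (real k + 1/2) * h)))"
proof -
  define a b where "a = norm (U (x + real k * h)) + norm (U (x - real k * h))"
    and "b = norm (U (x + (real k + 1/2) * h)) + norm (U (x - (real k + 1/2) * h))"
  have ab: "a \<ge> 0" "b \<ge> 0" by (auto simp: a_def b_def)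
  have "norm (kadec_term d h U x k) \<le> \<bar>kadec_cos d k / 2\<bar> * a + \<bar>kadec_sin d k / 2\<bar> * b"
    unfolding kadec_term_def a_def b_def
    by (rule order_trans[OF norm_triangle_ineq])
      (auto intro!: add_mono mult_left_mono norm_triangle_ineq norm_triangle_ineq4)
  also have "\<dots> \<le> (\<bar>kadec_cos d k\<bar> + \<bar>kadec_sin d k\<bar>) / 2 * (a + b)"
    using ab by (simp add: algebra_simps)
  finally show ?thesis by (simp add: a_def b_def algebra_simps)
qed

lemma kadec_term_zero: "kadec_term d h (\<lambda>x. 0) x = (\<lambda>k. 0)"
  by (simp add: kadec_term_def fun_eq_iff)

lemma kadec_term_add:
  "kadec_term d h (\<lambda>x. U x + V x) x k = kadec_term d h U x k + kadec_term d h V x k"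
  by (simp add: kadec_term_def algebra_simps)

lemma kadec_term_linear:
  assumes "linear f"
  shows "kadec_term d h (\<lambda>x. f (U x)) x k = f (kadec_term d h U x k)"
  by (simp add: kadec_term_def linear_add[OF assms] linear_diff[OF assms] linear_scale[OF assms])

lemma kadec_expands_add:
  "kadec_expands \<eta> U \<Longrightarrow> kadec_expands \<eta> V \<Longrightarrow> kadec_expands \<eta> (\<lambda>x. U x + V x)"
  unfolding kadec_expands_def kadec_term_add add_diff_add by (auto intro: sums_add)

lemma kadec_expands_mult_left:
  fixes c :: complex
  assumes "kadec_expands \<eta> U"
  shows "kadec_expands \<eta> (\<lambda>x. c * U x)"
proof -
  have "linear (\<lambda>z. c * z)"
    by (auto intro!: linearI simp: algebra_simps)
  then have "kadec_term d h (\<lambda>x. c * U x) x = (\<lambda>k. c * kadec_term d h U x k)" for d h x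
    by (intro ext kadec_term_linear)
  then show ?thesis
    using assms unfolding kadec_expands_def right_diff_distrib[symmetric] by (simp add: sums_mult)
qed

lemma kadec_expands_cis:
  assumes \<eta>: "\<eta> > 0" and l: "\<bar>l\<bar> \<le> \<eta>"
  shows "kadec_expands \<eta> (\<lambda>x. cis (l * x))"
  unfolding kadec_expands_def
proof (intro allI impI)
  fix x s :: real assume s: "\<bar>s\<bar> * \<eta> \<le> pi / 4"
  define t d where "t = l * pi / \<eta>" and "d = s * \<eta> / pi"
  have dt: "d * t = l * s" using \<eta> by (simp add: d_def t_def)
  have t: "\<bar>t\<bar> \<le> pi"
    using l \<eta> by (simp add: t_def abs_mult divide_le_eq mult.commute)
  have d: "\<bar>d\<bar> \<le> 1/4"
    using s \<eta> by (simp add: d_def abs_mult divide_le_eq)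
  have trm: "kadec_term d (pi / \<eta>) (\<lambda>x. cis (l * x)) x k
      = cis (l * x) * (of_real (kadec_cos d k * cos (real k * t)) +
          \<i> * of_real (kadec_sin d k * sin ((real k + 1/2) * t)))" for k
  proof -
    have e: "l * (x + a * (pi / \<eta>)) = l * x + a * t" "l * (x - a * (pi / \<eta>)) = l * x - a * t" for a
      using \<eta> by (simp_all add: t_def field_simps)
    have 1: "cis (l * x + a * t) + cis (l * x - a * t) = cis (l * x) * (2 * of_real (cos (a * t)))" for a
      by (simp add: complex_eq_iff cos_add cos_diff sin_add sin_diff)
    have 2: "cis (l * x + a * t) - cis (l * x - a * t) = cis (l * x) * (2 * \<i> * of_real (sin (a * t)))" for a
      by (simp add: complex_eq_iff cos_add cos_diff sin_add sin_diff)
    show ?thesis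
      unfolding kadec_term_def e 1 2 by (simp add: scaleR_conv_of_real algebra_simps)
  qed
  have "(\<lambda>k. cis (l * x) * (of_real (kadec_cos d k * cos (real k * t)) +
          \<i> * of_real (kadec_sin d k * sin ((real k + 1/2) * t))))
      sums (cis (l * x) * (of_real (cos (d * t) - 1) + \<i> * of_real (sin (d * t))))"
    by (intro sums_mult sums_add sums_of_real kadec_cos_expansion kadec_sin_expansion d t)
  moreover have "cis (l * x) * (of_real (cos (d * t) - 1) + \<i> * of_real (sin (d * t)))
      = cis (l * (x + s)) - cis (l * x)"
    by (simp add: dt complex_eq_iff cos_add sin_add algebra_simps)
  ultimately show "kadec_term (s * \<eta> / pi) (pi / \<eta>) (\<lambda>x. cis (l * x)) x sums (cis (l * (x + s)) - cis (l * x))"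
    unfolding d_def[symmetric] trm by simp
qed

text \<open>Two separate bounds permit the exchange of sum and integral: C y gives summability over
  k for each y, and the uniform bound K gives summability of the integrals. Keeping them apart
  allows C to be constant on the whole line, as happens for translates of the Fejer kernel.\<close>

lemma kadec_term_integral_sums:
  fixes \<Phi> :: "'m \<Rightarrow> real \<Rightarrow> complex"
  assumes int: "\<And>x. integrable M (\<lambda>y. \<Phi> y x)"
    and bdd: "\<And>y x. norm (\<Phi> y x) \<le> C y"
    and le: "\<And>x. (LINT y|M. norm (\<Phi> y x)) \<le> K"
    and d: "\<bar>d\<bar> \<le> 1/4"
  shows "kadec_term d h (\<lambda>x. LINT y|M. \<Phi> y x) x sums (LINT y|M. (\<Sum>k. kadec_term d h (\<Phi> y) x k))"
proof -
  define w where "w k = \<bar>kadec_cos d k\<bar> + \<bar>kadec_sin d k\<bar>" for k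
  have w: "summable w"
    unfolding w_def using sums_kadec_abs[OF d] by (rule sums_summable)
  have w0: "w k \<ge> 0" for k by (simp add: w_def)
  have intk: "integrable M (\<lambda>y. kadec_term d h (\<Phi> y) x k)" for k
    unfolding kadec_term_def
    by (intro Bochner_Integration.integrable_add integrable_scaleR_right Bochner_Integration.integrable_diff int)
  have eq: "(LINT y|M. kadec_term d h (\<Phi> y) x k) = kadec_term d h (\<lambda>x. LINT y|M. \<Phi> y x) x k" for k
    unfolding kadec_term_def using int by simp
  have sn: "summable (\<lambda>k. norm (kadec_term d h (\<Phi> y) x k))" for y
  proof (rule summable_comparison_test')
    show "summable (\<lambda>k. w k * C y)" by (intro summable_mult2 w)
    show "norm (norm (kadec_term d h (\<Phi> y) x k)) \<le> w k * C y" for k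
      using norm_kadec_term_le[of "\<Phi> y", OF bdd] by (simp add: w_def)
  qed
  have si: "summable (\<lambda>k. LINT y|M. norm (kadec_term d h (\<Phi> y) x k))"
  proof (rule summable_comparison_test')
    show "summable (\<lambda>k. w k * (2 * K))" by (intro summable_mult2 w)
    fix k :: nat
    let ?N = "\<lambda>a. LINT y|M. norm (\<Phi> y a)"
    have "(LINT y|M. norm (kadec_term d h (\<Phi> y) x k))
      \<le> (LINT y|M. w k / 2 * (norm (\<Phi> y (x + real k * h)) + norm (\<Phi> y (x - real k * h)) +
      norm (\<Phi> y (x + (real k + 1/2) * h)) + norm (\<Phi> y (x - (real k + 1/2) * h))))"
      using norm_kadec_term_le_sum[of d h "\<Phi> _" x k]
      by (intro integral_mono intk integrable_norm Bochner_Integration.integrable_add integrable_mult_right int)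
        (auto simp: w_def)
    also have "\<dots> = w k / 2 * (?N (x + real k * h) + ?N (x - real k * h) +
      ?N (x + (real k + 1/2) * h) + ?N (x - (real k + 1/2) * h))"
      using int by simp
    also have "\<dots> \<le> w k / 2 * (K + K + K + K)"
      by (intro mult_left_mono add_mono le) (simp add: w0)
    finally show "norm (LINT y|M. norm (kadec_term d h (\<Phi> y) x k)) \<le> w k * (2 * K)"
      by (simp add: mult_ac)
  qed
  show "kadec_term d h (\<lambda>x. LINT y|M. \<Phi> y x) x sums (LINT y|M. (\<Sum>k. kadec_term d h (\<Phi> y) x k))"
    using sums_integral[OF intk _ si] sn by (simp add: eq)
qed

lemma kadec_expands_integral:
  fixes \<Phi> :: "'m \<Rightarrow> real \<Rightarrow> complex"
  assumes \<eta>: "\<eta> > 0"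
    and int: "\<And>x. integrable M (\<lambda>y. \<Phi> y x)"
    and bdd: "\<And>y x. norm (\<Phi> y x) \<le> C y"
    and le: "\<And>x. (LINT y|M. norm (\<Phi> y x)) \<le> K"
    and ex: "\<And>y. kadec_expands \<eta> (\<Phi> y)"
  shows "kadec_expands \<eta> (\<lambda>x. LINT y|M. \<Phi> y x)"
  unfolding kadec_expands_def
proof (intro allI impI)
  fix x s :: real assume s: "\<bar>s\<bar> * \<eta> \<le> pi / 4"
  have d: "\<bar>s * \<eta> / pi\<bar> \<le> 1/4"
    using s \<eta> by (simp add: abs_mult divide_le_eq)
  have "(\<Sum>k. kadec_term (s * \<eta> / pi) (pi / \<eta>) (\<Phi> y) x k) = \<Phi> y (x + s) - \<Phi> y x" for y
    using ex[of y] s by (auto simp: kadec_expands_def intro: sums_unique[symmetric])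
  moreover have "kadec_term (s * \<eta> / pi) (pi / \<eta>) (\<lambda>x. LINT y|M. \<Phi> y x) x
      sums (LINT y|M. (\<Sum>k. kadec_term (s * \<eta> / pi) (pi / \<eta>) (\<Phi> y) x k))"
    by (rule kadec_term_integral_sums[OF int bdd le d])
  ultimately show "kadec_term (s * \<eta> / pi) (pi / \<eta>) (\<lambda>x. LINT y|M. \<Phi> y x) x
      sums ((LINT y|M. \<Phi> y (x + s)) - (LINT y|M. \<Phi> y x))"
    using int by simp
qed

text \<open>A Bernstein type estimate: the factor is the sum of the absolute coefficients at pi |d|
  = |s| \<eta>, and it is of order |s| \<eta> for small s.\<close>

lemma norm_diff_le_if_kadec_expands:
  fixes U :: "real \<Rightarrow> 'v::banach"
  assumes U: "kadec_expands \<eta> U" and bdd: "\<And>y. norm (U y) \<le> C" and s: "\<bar>s\<bar> * \<eta> \<le> pi / 4"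
    and \<eta>: "\<eta> > 0"
  shows "norm (U (x + s) - U x) \<le> (1 - cos (s * \<eta>) + sin (\<bar>s\<bar> * \<eta>)) * C"
proof -
  define d where "d = s * \<eta> / pi"
  have d: "\<bar>d\<bar> \<le> 1/4"
    using s \<eta> by (simp add: d_def abs_mult divide_le_eq)
  have sums: "kadec_term d (pi / \<eta>) U x sums (U (x + s) - U x)"
    using U s by (auto simp: kadec_expands_def d_def)
  have w: "(\<lambda>k. (\<bar>kadec_cos d k\<bar> + \<bar>kadec_sin d k\<bar>) * C) sums ((1 - cos (pi * d) + sin (pi * \<bar>d\<bar>)) * C)"
    by (intro sums_mult2 sums_kadec_abs d)
  have "norm (U (x + s) - U x) \<le> (1 - cos (pi * d) + sin (pi * \<bar>d\<bar>)) * C"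
    by (rule norm_sums_le[OF sums w]) (intro norm_kadec_term_le bdd)
  also have "pi * d = s * \<eta>" by (simp add: d_def)
  also have "pi * \<bar>d\<bar> = \<bar>s\<bar> * \<eta>" using \<eta> by (simp add: d_def abs_mult)
  finally show ?thesis .
qed

section \<open>Convolution and Fejer kernels\<close>

definition conv :: "(real \<Rightarrow> complex) \<Rightarrow> (real \<Rightarrow> complex) \<Rightarrow> real \<Rightarrow> complex" where
  "conv f g x = (LINT y|lborel. f (x - y) * g y)"

lemma conv_commute: "conv f g x = conv g f x"
  unfolding conv_def
  by (subst lborel_integral_real_affine[where c="-1" and t=x]) (simp_all add: mult.commute)

text \<open>The Fejer kernel at frequency \<open>\<xi>\<close>; its Fourier transform is supported in
  \<open>[\<xi> - 2e, \<xi> + 2e]\<close>.\<close>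

definition fejer :: "real \<Rightarrow> real \<Rightarrow> real \<Rightarrow> complex" where
  "fejer \<xi> e z = complex_of_real ((sinc (e * z))\<^sup>2) * cis (\<xi> * z)"

lemma abs_sinc_le_1: "\<bar>sinc x\<bar> \<le> 1"
  using abs_sin_x_le_abs_x[of x] by (auto simp: abs_div divide_le_eq)

lemma norm_fejer: "norm (fejer \<xi> e z) = (sinc (e * z))\<^sup>2"
  by (simp add: fejer_def norm_mult del: of_real_power)

lemma norm_fejer_le_1: "norm (fejer \<xi> e z) \<le> 1"
  using abs_sinc_le_1[of "e * z"] by (simp only: norm_fejer abs_square_le_1)

lemma continuous_on_fejer [continuous_intros]:
  "continuous_on A f \<Longrightarrow> continuous_on A (\<lambda>x. fejer \<xi> e (f x))"
  unfolding fejer_def by (intro continuous_intros continuous_on_cis)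

lemma borel_measurable_fejer [measurable]: "fejer \<xi> e \<in> borel_measurable borel"
  by (intro borel_measurable_continuous_onI continuous_on_fejer continuous_on_id)

lemma integrable_sinc_sq: "integrable lborel (\<lambda>z. (sinc z)\<^sup>2)"
proof (rule Bochner_Integration.integrable_bound)
  show "integrable lborel (\<lambda>z::real. 2 * inverse (1 + z\<^sup>2))"
    using integrable_inverse_1_plus_square by (simp add: set_integrable_def)
  show "(\<lambda>z. (sinc z)\<^sup>2) \<in> borel_measurable lborel" by measurable
  have "(sinc z)\<^sup>2 \<le> 2 * inverse (1 + z\<^sup>2)" for z :: real
  proof (cases "z\<^sup>2 \<le> 1")
    case True
    have "(sinc z)\<^sup>2 \<le> 1" using abs_sinc_le_1[of z] by (simp only: abs_square_le_1)
    also have "1 \<le> 2 * inverse (1 + z\<^sup>2)"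
      using True by (simp add: field_simps add_pos_nonneg)
    finally show ?thesis .
  next
    case False
    then have z: "z \<noteq> 0" by auto
    have "(sin z)\<^sup>2 \<le> 1" using abs_sin_le_one[of z] by (simp only: abs_square_le_1)
    then have "(sinc z)\<^sup>2 \<le> 1 / z\<^sup>2"
      using z by (simp add: power_divide divide_right_mono)
    also have "\<dots> \<le> 2 * inverse (1 + z\<^sup>2)"
      using False z by (simp add: field_simps add_pos_nonneg)
    finally show ?thesis .
  qed
  moreover have "2 * inverse (1 + z\<^sup>2) \<ge> 0" for z :: real by simp
  ultimately show "AE z in lborel. norm ((sinc z)\<^sup>2) \<le> norm (2 * inverse (1 + z\<^sup>2))"
    by (intro AE_I2) (simp del: inverse_eq_divide)
qed

lemma integrable_fejer:
  assumes "e > 0"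
  shows "integrable lborel (fejer \<xi> e)"
proof (rule Bochner_Integration.integrable_bound)
  show "integrable lborel (\<lambda>z. (sinc (e * z))\<^sup>2)"
    using lborel_integrable_real_affine[OF integrable_sinc_sq, of e 0] assms by (simp cong: if_cong)
qed (auto simp only: norm_fejer intro!: AE_I2, auto)

text \<open>With t = e z / 2 this is sinc (2 t) = sinc t cos t together with 4 (cos t)^2 = 2 + cis
  (2 t) + cis (-2 t). In frequency, a triangle is a weighted sum of three triangles of half the
  width inside its support.\<close>

lemma fejer_double:
  "fejer \<xi> e z = (2 * fejer \<xi> (e / 2) z + fejer (\<xi> + e) (e / 2) z + fejer (\<xi> - e) (e / 2) z) / 4"
proof -
  define t where "t = e * z / 2"
  have e: "e * z = 2 * t" "e / 2 * z = t" "(\<xi> + e) * z = \<xi> * z + 2 * t" "(\<xi> - e) * z = \<xi> * z - 2 * t"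
    by (simp_all add: t_def algebra_simps)
  have s: "sinc (2 * t) = sinc t * cos t"
    by (simp add: sin_double)
  have "2 * cis (\<xi> * z) + cis (\<xi> * z + 2 * t) + cis (\<xi> * z - 2 * t) = 4 * of_real ((cos t)\<^sup>2) * cis (\<xi> * z)"
    by (simp add: complex_eq_iff cos_add cos_diff sin_add sin_diff cos_double_cos) (simp add: algebra_simps)
  moreover define S where "S = complex_of_real ((sinc t)\<^sup>2)"
  have "2 * fejer \<xi> (e / 2) z + fejer (\<xi> + e) (e / 2) z + fejer (\<xi> - e) (e / 2) z
      = S * (2 * cis (\<xi> * z) + cis (\<xi> * z + 2 * t) + cis (\<xi> * z - 2 * t))"
    unfolding fejer_def e S_def[symmetric] by (simp add: algebra_simps)
  ultimately have "2 * fejer \<xi> (e / 2) z + fejer (\<xi> + e) (e / 2) z + fejer (\<xi> - e) (e / 2) z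
      = S * (4 * of_real ((cos t)\<^sup>2) * cis (\<xi> * z))"
    by simp
  also have "\<dots> = 4 * fejer \<xi> e z"
    unfolding fejer_def e s S_def by (simp add: power_mult_distrib)
  finally show ?thesis by simp
qed

text \<open>Fourier inversion for the triangle on [-1, 1], folded by symmetry onto [0, 1]. It
  exhibits the Fejer kernel as a superposition of characters.\<close>

lemma has_bochner_integral_sinc_sq:
  "has_bochner_integral lborel (\<lambda>l. indicator {0..1} l *\<^sub>R (2 * (1 - l) * cos (2 * l * z))) ((sinc z)\<^sup>2)"
proof (cases "z = 0")
  case True
  have "has_bochner_integral lborel (\<lambda>l::real. indicator {0..1} l *\<^sub>R (2 * (1 - l))) ((2 * 1 - 1\<^sup>2) - (2 * 0 - 0\<^sup>2))"
    by (rule has_bochner_integral_FTC_Icc)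
      (auto intro!: derivative_eq_intros continuous_intros
        simp: has_real_derivative_iff_has_vector_derivative[symmetric])
  then show ?thesis using True by simp
next
  case False
  define F where "F l = (1 - l) * sin (2 * l * z) / z - cos (2 * l * z) / (2 * z\<^sup>2)" for l
  have "has_bochner_integral lborel (\<lambda>l::real. indicator {0..1} l *\<^sub>R (2 * (1 - l) * cos (2 * l * z))) (F 1 - F 0)"
    unfolding F_def using False
    by (intro has_bochner_integral_FTC_Icc)
      (auto intro!: derivative_eq_intros continuous_intros
        simp: has_real_derivative_iff_has_vector_derivative[symmetric] field_simps power2_eq_square)
  moreover have "F 1 - F 0 = (1 - cos (2 * z)) / (2 * z\<^sup>2)"
    by (simp add: F_def diff_divide_distrib)
  moreover have "\<dots> = (sinc z)\<^sup>2"
    unfolding cos_double_sin using False by (simp add: power_divide)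
  ultimately show ?thesis by simp
qed

lemma kadec_expands_fejer:
  assumes \<eta>: "\<bar>\<xi>\<bar> + 2 * e \<le> \<eta>" and e: "e > 0"
  shows "kadec_expands \<eta> (fejer \<xi> e)"
proof -
  define \<Phi> where "\<Phi> l z = complex_of_real (indicator {0..1} l * (2 * (1 - l) * cos (2 * l * (e * z)))) * cis (\<xi> * z)"
    for l z
  have hb: "has_bochner_integral lborel (\<lambda>l. \<Phi> l z) (fejer \<xi> e z)" for z
    unfolding \<Phi>_def fejer_def
    using has_bochner_integral_sinc_sq[of "e * z"]
    by (intro has_bochner_integral_mult_left has_bochner_integral_of_real) simp
  have bd: "norm (\<Phi> l z) \<le> 2 * indicator {0..1} l" for l z
  proof (cases "l \<in> {0..1}")
    case True
    have "\<bar>1 - l\<bar> * \<bar>cos (2 * l * (e * z))\<bar> \<le> 1 * 1"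
      using True by (intro mult_mono) auto
    then show ?thesis using True by (simp add: \<Phi>_def norm_mult abs_mult del: of_real_mult)
      (simp add: algebra_simps)
  qed (simp add: \<Phi>_def)
  have "kadec_expands \<eta> (\<lambda>z. LINT l|lborel. \<Phi> l z)"
  proof (rule kadec_expands_integral[where C="\<lambda>l. 2 * indicator {0..1} l" and K=2])
    show int: "integrable lborel (\<lambda>l. \<Phi> l z)" for z
      using hb by (rule integrable.intros)
    show "(LINT l|lborel. norm (\<Phi> l z)) \<le> 2" for z
    proof -
      have "(LINT l|lborel. norm (\<Phi> l z)) \<le> (LINT l|lborel. 2 * indicator {0..1::real} l)"
        by (intro integral_mono integrable_norm int bd) auto
      then show ?thesis by simp
    qed
    show "kadec_expands \<eta> (\<Phi> l)" for l
    proof -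
      define c where "c = complex_of_real (indicator {0..1} l * (1 - l))"
      \<comment> \<open>Twice the cosine splits into two characters, with frequencies \<xi> + 2 l e
        and \<xi> - 2 l e; for l in [0, 1] both have modulus at most \<eta>.\<close>
      have "\<Phi> l = (\<lambda>z. c * (cis ((\<xi> + 2 * l * e) * z) + cis ((\<xi> - 2 * l * e) * z)))"
        by (auto simp: fun_eq_iff \<Phi>_def c_def complex_eq_iff distrib_right left_diff_distrib
          cos_add cos_diff sin_add sin_diff mult.assoc)
      moreover have "kadec_expands \<eta> (\<lambda>z. c * (cis ((\<xi> + 2 * l * e) * z) + cis ((\<xi> - 2 * l * e) * z)))"
      proof (cases "l \<in> {0..1}")
        case True
        have "\<bar>2 * l * e\<bar> \<le> 2 * e" using True e by (simp add: abs_mult mult_left_le_one_le)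
        then have "\<bar>\<xi> + 2 * l * e\<bar> \<le> \<eta>" "\<bar>\<xi> - 2 * l * e\<bar> \<le> \<eta>" "\<eta> > 0"
          using \<eta> e by linarith+
        then show ?thesis
          by (intro kadec_expands_mult_left kadec_expands_add kadec_expands_cis)
      next
        case False
        then have "c = 0" by (simp add: c_def)
        then show ?thesis by (simp add: kadec_expands_def kadec_term_zero)
      qed
      ultimately show ?thesis by simp
    qed
  qed (use \<eta> e bd in auto)
  then show ?thesis
    by (simp add: has_bochner_integral_integral_eq[OF hb])
qed

lemma kadec_term_shift: "kadec_term d h (\<lambda>x. U (x - y)) x k = kadec_term d h U (x - y) k"
  by (simp add: kadec_term_def algebra_simps)

lemma kadec_expands_shift:
  assumes "kadec_expands \<eta> U"
  shows "kadec_expands \<eta> (\<lambda>x. U (x - y))"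
proof -
  have "kadec_term d h (\<lambda>x. U (x - y)) x = kadec_term d h U (x - y)" for d h x
    by (intro ext kadec_term_shift)
  then show ?thesis
    using assms unfolding kadec_expands_def by (simp add: diff_add_eq[symmetric])
qed

lemma kadec_term_mult_right:
  "kadec_term d h (\<lambda>x. U x * c) x k = kadec_term d h U x k * (c::complex)"
  by (simp add: kadec_term_def algebra_simps)

lemma
  fixes u k :: "real \<Rightarrow> complex"
  assumes [measurable]: "u \<in> borel_measurable borel" and u: "\<And>y. norm (u y) \<le> C"
    and k: "integrable lborel k"
  shows integrable_conv: "integrable lborel (\<lambda>y. u (x - y) * k y)"
    and integral_norm_conv_le: "(LINT y|lborel. norm (u (x - y) * k y)) \<le> C * (LINT y|lborel. norm (k y))"
    and norm_conv_le: "norm (conv u k x) \<le> C * (LINT y|lborel. norm (k y))"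
proof -
  have [measurable]: "k \<in> borel_measurable borel"
    using borel_measurable_integrable[OF k] by simp
  have C: "C \<ge> 0" using u[of 0] norm_ge_zero order_trans by blast
  have le: "norm (u (x - y) * k y) \<le> C * norm (k y)" for y
    by (simp add: norm_mult mult_right_mono u)
  have ik: "integrable lborel (\<lambda>y. C * norm (k y))"
    using k by auto
  show 1: "integrable lborel (\<lambda>y. u (x - y) * k y)"
  proof (rule Bochner_Integration.integrable_bound[OF ik])
    show "AE y in lborel. norm (u (x - y) * k y) \<le> norm (C * norm (k y))"
      using le C by (simp add: abs_mult)
  qed measurable
  have "(LINT y|lborel. norm (u (x - y) * k y)) \<le> (LINT y|lborel. C * norm (k y))"
    by (intro integral_mono integrable_norm 1 ik le)
  then show 2: "(LINT y|lborel. norm (u (x - y) * k y)) \<le> C * (LINT y|lborel. norm (k y))"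
    by simp
  show "norm (conv u k x) \<le> C * (LINT y|lborel. norm (k y))"
    unfolding conv_def by (rule order_trans[OF integral_norm_bound 2])
qed

text \<open>An instance of Fubini. Its use: an f whose convolution with u vanishes also annihilates
  every Fejer mean of u.\<close>

lemma conv_swap:
  fixes u k f :: "real \<Rightarrow> complex"
  assumes [measurable]: "u \<in> borel_measurable borel" and u: "\<And>y. norm (u y) \<le> C"
    and k: "integrable lborel k" and f: "integrable lborel f"
  shows "conv (conv u k) f x = conv (conv u f) k x"
proof -
  have [measurable]: "k \<in> borel_measurable borel" "f \<in> borel_measurable borel"
    using borel_measurable_integrable[OF k] borel_measurable_integrable[OF f] by simp_all
  have e: "(x - t) - y = (x - y) - t" for x y t :: real by simp
  have i1: "integrable lborel (\<lambda>y. u (x - t - y) * k y * f t)" for t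
    by (intro integrable_mult_left integrable_conv[OF _ u k]) simp
  have "integrable (lborel \<Otimes>\<^sub>M lborel) (\<lambda>(t, y). u (x - t - y) * k y * f t)"
  proof (rule lborel_pair.Fubini_integrable)
    have "integrable lborel (\<lambda>t. LINT y|lborel. norm (u (x - t - y) * k y * f t))"
    proof (rule Bochner_Integration.integrable_bound)
      show "integrable lborel (\<lambda>t. C * (LINT y|lborel. norm (k y)) * norm (f t))"
        using f by auto
      have C: "C \<ge> 0" using u[of 0] norm_ge_zero order_trans by blast
      have "(LINT y|lborel. norm (u (x - t - y) * k y * f t)) \<le> C * (LINT y|lborel. norm (k y)) * norm (f t)" for t
        using mult_right_mono[OF integral_norm_conv_le[OF assms(1) u k, of "x - t"], of "norm (f t)"]
        by (simp add: norm_mult)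
      then show "AE t in lborel. norm (LINT y|lborel. norm (u (x - t - y) * k y * f t))
          \<le> norm (C * (LINT y|lborel. norm (k y)) * norm (f t))"
        using C by (simp add: abs_mult)
    qed measurable
    then show "integrable lborel (\<lambda>t. LINT y|lborel. norm (case (t, y) of (t, y) \<Rightarrow> u (x - t - y) * k y * f t))"
      by simp
  qed (use i1 in auto)
  from lborel_pair.Fubini_integral[OF this]
  have "(LINT y|lborel. LINT t|lborel. u (x - t - y) * k y * f t)
      = (LINT t|lborel. LINT y|lborel. u (x - t - y) * k y * f t)" .
  moreover have "(LINT t|lborel. LINT y|lborel. u (x - t - y) * k y * f t) = conv (conv u k) f x"
    by (simp add: conv_def)
  moreover have "(LINT y|lborel. LINT t|lborel. u (x - t - y) * k y * f t)
      = (LINT y|lborel. LINT t|lborel. u (x - y - t) * f t * k y)"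
    by (simp add: e[of x] mult_ac)
  moreover have "\<dots> = conv (conv u f) k x"
    by (simp add: conv_def)
  ultimately show ?thesis by simp
qed

text \<open>The mean is a superposition of translates of the kernel with weights u y, so the
  frequencies of the kernel alone decide.\<close>

lemma kadec_expands_conv_fejer:
  assumes u[measurable]: "u \<in> borel_measurable borel" and C: "\<And>y. norm (u y) \<le> C"
    and e: "e > 0" and \<eta>: "\<bar>\<xi>\<bar> + 2 * e \<le> \<eta>"
  shows "kadec_expands \<eta> (conv u (fejer \<xi> e))"
proof -
  have \<eta>0: "\<eta> > 0" using e \<eta> by linarith
  have ik: "integrable lborel (\<lambda>y. u (x - y) * fejer \<xi> e y)" for x
    by (intro integrable_conv[OF u C] integrable_fejer e)
  have "kadec_expands \<eta> (\<lambda>x. LINT y|lborel. fejer \<xi> e (x - y) * u y)"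
  proof (rule kadec_expands_integral[where C="\<lambda>y. C"])
    show "integrable lborel (\<lambda>y. fejer \<xi> e (x - y) * u y)" for x
      using lborel_integrable_real_affine[OF ik, of "-1" x x] by (simp add: mult.commute)
    show "norm (fejer \<xi> e (x - y) * u y) \<le> C" for x y
      using mult_mono[OF norm_fejer_le_1[of \<xi> e "x - y"] C[of y]] by (simp add: norm_mult)
    show "(LINT y|lborel. norm (fejer \<xi> e (x - y) * u y)) \<le> C * (LINT y|lborel. norm (fejer \<xi> e y))" for x
      using integral_norm_conv_le[OF u C integrable_fejer[OF e], of x \<xi>]
        lborel_integral_real_affine[of "-1" "\<lambda>y. norm (u (x - y) * fejer \<xi> e y)" x]
      by (simp add: mult.commute)
    show "kadec_expands \<eta> (\<lambda>x. fejer \<xi> e (x - y) * u y)" for y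
      unfolding mult.commute[of _ "u y"]
      by (intro kadec_expands_mult_left kadec_expands_shift kadec_expands_fejer e \<eta>)
  qed (rule \<eta>0)
  moreover have "(\<lambda>x. LINT y|lborel. fejer \<xi> e (x - y) * u y) = conv u (fejer \<xi> e)"
    unfolding conv_commute[of u] by (simp add: conv_def fun_eq_iff)
  ultimately show ?thesis by simp
qed

text \<open>The mean \<open>H\<close> is annihilated by \<open>f\<close>, so \<open>H x\<close> times the integral of \<open>f\<close> equals the integral
  of \<open>f t * (H x - H (x - t))\<close>, which the Bernstein estimate for \<open>H\<close> makes too small unless
  \<open>sup \<bar>H\<bar> = 0\<close>.\<close>

lemma conv_fejer_eq_0_aux:
  fixes u f :: "real \<Rightarrow> complex"
  assumes u[measurable]: "u \<in> borel_measurable borel" and C: "\<And>y. norm (u y) \<le> C"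
    and f: "integrable lborel f" and 0: "\<And>x. conv u f x = 0"
    and e: "e > 0"
    and small: "(LINT t|lborel. norm (f t) * min 2 (8 * e * \<bar>t\<bar>)) < norm (LINT t|lborel. f t)"
  shows "conv u (fejer 0 e) x = 0"
proof -
  define H where "H = conv u (fejer 0 e)"
  define M where "M = (SUP x. norm (H x))"
  have [measurable]: "f \<in> borel_measurable borel"
    using borel_measurable_integrable[OF f] by simp
  have Hm [measurable]: "H \<in> borel_measurable borel"
    unfolding H_def conv_def[abs_def] by measurable
  have bd: "bdd_above (range (\<lambda>x. norm (H x)))"
    unfolding H_def using norm_conv_le[OF u C integrable_fejer[OF e]] by (auto simp: bdd_above_def)
  have HM: "norm (H x) \<le> M" for x
    unfolding M_def by (intro cSUP_upper bd) auto
  have M0: "M \<ge> 0" using HM[of 0] norm_ge_zero order_trans by blast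
  \<comment> \<open>The kernel of width e centred at 0 has frequencies up to 2 e.\<close>
  have ex: "kadec_expands (2 * e) H"
    unfolding H_def by (rule kadec_expands_conv_fejer[OF u C e]) simp
  have diff: "norm (H x - H (x - t)) \<le> M * min 2 (8 * e * \<bar>t\<bar>)" for x t
  proof -
    have "norm (H x - H (x - t)) \<le> M + M"
      using norm_triangle_ineq4[of "H x" "H (x - t)"] HM[of x] HM[of "x - t"] by linarith
    then have 1: "norm (H x - H (x - t)) \<le> M * 2" by simp
    \<comment> \<open>Within the range of the expansion the factor is at most 2 |a| = 4 e |t|. The
      larger bound 8 e |t| is chosen because outside that range it exceeds pi, hence also the
      trivial 2.\<close>
    have 2: "norm (H x - H (x - t)) \<le> M * (8 * e * \<bar>t\<bar>)"
    proof (cases "\<bar>t\<bar> * (2 * e) \<le> pi / 4")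
      case True
      define a where "a = t * (2 * e)"
      have a: "\<bar>a\<bar> = \<bar>t\<bar> * (2 * e)" using e by (simp add: a_def abs_mult)
      have a1: "\<bar>a\<bar> \<le> 1" using True a pi_less_4 by linarith
      have "norm (H (x + (- t)) - H x) \<le> (1 - cos ((- t) * (2 * e)) + sin (\<bar>- t\<bar> * (2 * e))) * M"
        using True e by (intro norm_diff_le_if_kadec_expands[OF ex HM]) auto
      then have "norm (H x - H (x - t)) \<le> (1 - cos a + sin \<bar>a\<bar>) * M"
        using e by (simp add: a_def abs_mult norm_minus_commute)
      also have "\<dots> \<le> (2 * \<bar>a\<bar>) * M"
      proof (rule mult_right_mono[OF _ M0])
        have s: "\<bar>sin (a / 2)\<bar> \<le> \<bar>a / 2\<bar>" by (rule abs_sin_x_le_abs_x)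
        have "1 - cos a = 2 * (\<bar>sin (a / 2)\<bar> * \<bar>sin (a / 2)\<bar>)"
          using cos_double_sin[of "a / 2"] by (simp add: power2_eq_square)
        also have "\<dots> \<le> 2 * (\<bar>a / 2\<bar> * 1)"
          using s by (intro mult_left_mono mult_mono) auto
        finally show "1 - cos a + sin \<bar>a\<bar> \<le> 2 * \<bar>a\<bar>"
          using abs_sin_x_le_abs_x[of "\<bar>a\<bar>"] by simp
      qed
      also have "\<dots> \<le> M * (8 * e * \<bar>t\<bar>)"
        using M0 e by (simp add: a mult_ac mult_left_mono)
      finally show ?thesis .
    next
      case False
      then have "2 \<le> 8 * e * \<bar>t\<bar>" using pi_gt3 by (simp add: mult_ac)
      then show ?thesis using 1 M0 mult_left_mono order_trans by blast
    qed
    show ?thesis using 1 2 by (simp add: min_def)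
  qed
  have conv0: "conv H f x = 0" for x
  proof -
    have "conv H f x = conv (conv u f) (fejer 0 e) x"
      unfolding H_def by (rule conv_swap[OF u C integrable_fejer[OF e] f])
    then show ?thesis using 0 by (simp add: conv_def[of "conv u f"])
  qed
  define I where "I = (LINT t|lborel. norm (f t) * min 2 (8 * e * \<bar>t\<bar>))"
  have ibd: "integrable lborel (\<lambda>t. norm (f t) * min 2 (8 * e * \<bar>t\<bar>))"
  proof (rule Bochner_Integration.integrable_bound)
    show "integrable lborel (\<lambda>t. norm (f t) * 2)" using f by auto
    show "AE t in lborel. norm (norm (f t) * min 2 (8 * e * \<bar>t\<bar>)) \<le> norm (norm (f t) * 2)"
      using e by (intro AE_I2) (auto simp: abs_mult intro!: mult_left_mono)
  qed measurable
  have iH: "integrable lborel (\<lambda>t. H (x - t) * f t)" for x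
    by (rule integrable_conv[OF Hm HM f])
  have "norm (H x) * norm (LINT t|lborel. f t) \<le> M * I" for x
  proof -
    have "H x * (LINT t|lborel. f t) = (LINT t|lborel. H x * f t) - conv H f x"
      using f conv0 by simp
    also have "\<dots> = (LINT t|lborel. H x * f t - H (x - t) * f t)"
      unfolding conv_def using f iH by simp
    finally have "norm (H x) * norm (LINT t|lborel. f t) = norm (LINT t|lborel. H x * f t - H (x - t) * f t)"
      by (metis norm_mult)
    also have "\<dots> \<le> (LINT t|lborel. norm (H x * f t - H (x - t) * f t))"
      by (rule integral_norm_bound)
    also have "\<dots> \<le> (LINT t|lborel. M * (norm (f t) * min 2 (8 * e * \<bar>t\<bar>)))"
    proof (rule integral_mono)
      show "integrable lborel (\<lambda>t. norm (H x * f t - H (x - t) * f t))"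
        using f iH by auto
      show "integrable lborel (\<lambda>t. M * (norm (f t) * min 2 (8 * e * \<bar>t\<bar>)))"
        using ibd by (rule integrable_mult_right)
      show "norm (H x * f t - H (x - t) * f t) \<le> M * (norm (f t) * min 2 (8 * e * \<bar>t\<bar>))" for t
        using mult_left_mono[OF diff[of x t], of "norm (f t)"]
        unfolding left_diff_distrib[symmetric] norm_mult by (simp add: mult_ac)
    qed
    also have "\<dots> = M * I" by (simp add: I_def)
    finally show ?thesis .
  qed
  moreover have c0: "norm (LINT t|lborel. f t) > 0"
  proof -
    have "I \<ge> 0" unfolding I_def using e by (intro Bochner_Integration.integral_nonneg) auto
    then show ?thesis using small I_def by linarith
  qed
  ultimately have "norm (H x) \<le> M * I / norm (LINT t|lborel. f t)" for x
    by (simp add: pos_le_divide_eq)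
  \<comment> \<open>The quotient of I by the modulus of the integral of f is below 1, so this
    inequality forces M = 0.\<close>
  then have "M \<le> M * I / norm (LINT t|lborel. f t)"
    unfolding M_def by (intro cSUP_least) auto
  then have "M * (norm (LINT t|lborel. f t) - I) \<le> 0"
    using c0 by (simp add: pos_le_divide_eq algebra_simps)
  then have "M \<le> 0"
    using small I_def by (auto simp: mult_le_0_iff)
  then have "norm (H x) \<le> 0"
    using HM[of x] by linarith
  then show ?thesis by (simp add: H_def)
qed

lemma norm_cis_diff_le: "norm (cis a - cis b) \<le> \<bar>a - b\<bar>"
proof -
  have "cis a - cis b = cis b * (cis (a - b) - 1)"
    by (simp add: algebra_simps cis_mult)
  then have "norm (cis a - cis b) = 2 * \<bar>sin ((a - b) / 2)\<bar>"
    using dist_exp_i_1[of "a - b"] by (simp add: norm_mult cis_conv_exp)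
  then show ?thesis
    using abs_sin_x_le_abs_x[of "(a - b) / 2"] by simp
qed

text \<open>Modulation by \<open>cis (- (\<xi> * t))\<close> moves the frequency \<xi> to 0, where
  the Bernstein argument applies. One radius must serve all nearby \<xi> and e: the weighted
  integral \<open>I r\<close> decreases with r and tends to 0 along r = 1 / (n + 1) by dominated
  convergence.\<close>

lemma conv_fejer_eq_0_near:
  fixes u f :: "real \<Rightarrow> complex"
  assumes u[measurable]: "u \<in> borel_measurable borel" and C: "\<And>y. norm (u y) \<le> C"
    and f: "integrable lborel f" and 0: "\<And>x. conv u f x = 0"
    and ne: "(LINT t|lborel. f t * cis (- (\<xi>0 * t))) \<noteq> 0"
  shows "\<exists>r>0. \<forall>\<xi> e x. \<bar>\<xi> - \<xi>0\<bar> < r \<and> 0 < e \<and> e < r \<longrightarrow> conv u (fejer \<xi> e) x = 0"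
proof -
  have fm [measurable]: "f \<in> borel_measurable borel"
    using borel_measurable_integrable[OF f] by simp
  define I where "I r = (LINT t|lborel. norm (f t) * min 2 (8 * r * \<bar>t\<bar>))" for r
  have cm [measurable]: "cis \<in> borel_measurable borel"
    by (intro borel_measurable_continuous_onI continuous_on_cis continuous_on_id)
  have ib: "integrable lborel (\<lambda>t. norm (f t) * min 2 (8 * r * \<bar>t\<bar>))" if "r > 0" for r
  proof (rule Bochner_Integration.integrable_bound)
    show "integrable lborel (\<lambda>t. norm (f t) * 2)" using f by auto
    show "AE t in lborel. norm (norm (f t) * min 2 (8 * r * \<bar>t\<bar>)) \<le> norm (norm (f t) * 2)"
      using that by (intro AE_I2) (auto simp: abs_mult intro!: mult_left_mono)
  qed measurable
  have "(\<lambda>n. I (1 / real (Suc n))) \<longlonglongrightarrow> (LINT t::real|lborel. 0)"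
    unfolding I_def
  proof (rule integral_dominated_convergence)
    show "integrable lborel (\<lambda>t. norm (f t) * 2)" using f by auto
    show "AE t in lborel. (\<lambda>n. norm (f t) * min 2 (8 * (1 / real (Suc n)) * \<bar>t\<bar>)) \<longlonglongrightarrow> 0"
    proof (rule AE_I2)
      fix t
      have "(\<lambda>n. norm (f t) * min 2 (8 * (1 / real (Suc n)) * \<bar>t\<bar>)) \<longlonglongrightarrow> norm (f t) * min 2 (8 * 0 * \<bar>t\<bar>)"
        by (intro tendsto_intros LIMSEQ_Suc[OF lim_1_over_n])
      then show "(\<lambda>n. norm (f t) * min 2 (8 * (1 / real (Suc n)) * \<bar>t\<bar>)) \<longlonglongrightarrow> 0" by simp
    qed
    show "AE t in lborel. norm (norm (f t) * min 2 (8 * (1 / real (Suc n)) * \<bar>t\<bar>)) \<le> norm (f t) * 2" for n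
      by (intro AE_I2) (auto simp: abs_mult intro!: mult_left_mono)
  qed measurable
  then have I0: "(\<lambda>n. I (1 / real (Suc n))) \<longlonglongrightarrow> 0" by simp
  define c where "c = norm (LINT t|lborel. f t * cis (- (\<xi>0 * t)))"
  have c: "c / 2 > 0" using ne by (simp add: c_def)
  \<comment> \<open>Half of c, because \<open>I r\<close> is spent twice: on the left side of the
    smallness condition, and on the distance between the Fourier transforms of f at
    \<open>\<xi>0\<close> and at \<xi>.\<close>
  obtain n where n: "I (1 / real (Suc n)) < c / 2"
    using order_tendstoD(2)[OF I0 c] by (auto simp: eventually_sequentially)
  define r where "r = 1 / real (Suc n)"
  have r: "r > 0" "I r < c / 2" using n by (auto simp: r_def)
  have mono: "norm (f t) * min 2 (8 * s * \<bar>t\<bar>) \<le> norm (f t) * min 2 (8 * r * \<bar>t\<bar>)" if "s \<le> r" for s t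
    using that by (intro mult_left_mono min.mono mult_right_mono) auto
  have "conv u (fejer \<xi> e) x = 0" if \<xi>: "\<bar>\<xi> - \<xi>0\<bar> < r" and e: "0 < e" "e < r" for \<xi> e x
  proof -
    define u' where "u' y = u y * cis (- (\<xi> * y))" for y
    define f' where "f' t = f t * cis (- (\<xi> * t))" for t
    have u'm: "u' \<in> borel_measurable borel" unfolding u'_def by measurable
    have u'C: "norm (u' y) \<le> C" for y by (simp add: u'_def norm_mult C)
    have fi: "integrable lborel (\<lambda>t. f t * cis (- (a * t)))" for a
      by (rule Bochner_Integration.integrable_bound[OF f]) (auto simp: norm_mult)
    have f'i: "integrable lborel f'" unfolding f'_def by (rule fi)
    have split: "cis (- (\<xi> * (x - t))) * cis (- (\<xi> * t)) = cis (- (\<xi> * x))" for x t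
      by (simp add: cis_mult algebra_simps)
    have conv': "conv u' f' x = cis (- (\<xi> * x)) * conv u f x" for x
    proof -
      have "u' (x - t) * f' t = cis (- (\<xi> * x)) * (u (x - t) * f t)" for t
        unfolding u'_def f'_def split[of x t, symmetric] by (simp add: mult_ac)
      then show ?thesis by (simp add: conv_def)
    qed
    have "conv u' (fejer 0 e) x = 0"
    proof (rule conv_fejer_eq_0_aux[OF u'm u'C f'i _ e(1)])
      show "conv u' f' x = 0" for x by (simp add: conv' 0)
      have nf: "norm (f' t) = norm (f t)" for t by (simp add: f'_def norm_mult)
      have "(LINT t|lborel. norm (f' t) * min 2 (8 * e * \<bar>t\<bar>)) \<le> I r"
        unfolding nf I_def using e r(1) by (intro integral_mono ib mono) auto
      moreover have "norm ((LINT t|lborel. f t * cis (- (\<xi>0 * t))) - (LINT t|lborel. f' t)) \<le> I r"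
      proof -
        have eq: "(LINT t|lborel. f t * cis (- (\<xi>0 * t))) - (LINT t|lborel. f' t)
            = (LINT t|lborel. f t * cis (- (\<xi>0 * t)) - f' t)"
          using fi[of \<xi>0] f'i by simp
        have le: "(LINT t|lborel. norm (f t * cis (- (\<xi>0 * t)) - f' t)) \<le> I r"
          unfolding I_def
        proof (rule integral_mono[OF _ ib[OF r(1)]])
          show "integrable lborel (\<lambda>t. norm (f t * cis (- (\<xi>0 * t)) - f' t))"
            using fi[of \<xi>0] f'i by auto
          fix t
          have "norm (cis (- (\<xi>0 * t)) - cis (- (\<xi> * t))) \<le> \<bar>- (\<xi>0 * t) - - (\<xi> * t)\<bar>"
            by (rule norm_cis_diff_le)
          also have "\<dots> = \<bar>\<xi> - \<xi>0\<bar> * \<bar>t\<bar>"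
            by (simp add: abs_mult[symmetric] algebra_simps)
          also have "\<dots> \<le> 8 * r * \<bar>t\<bar>"
            using \<xi> r(1) by (intro mult_right_mono) auto
          finally have "norm (cis (- (\<xi>0 * t)) - cis (- (\<xi> * t))) \<le> min 2 (8 * r * \<bar>t\<bar>)"
            using norm_triangle_ineq4[of "cis (- (\<xi>0 * t))" "cis (- (\<xi> * t))"] by simp
          then show "norm (f t * cis (- (\<xi>0 * t)) - f' t) \<le> norm (f t) * min 2 (8 * r * \<bar>t\<bar>)"
            unfolding f'_def right_diff_distrib[symmetric] norm_mult by (intro mult_left_mono) auto
        qed
        show ?thesis
          unfolding eq by (rule order_trans[OF integral_norm_bound le])
      qed
      then have "c - norm (LINT t|lborel. f' t) \<le> I r"
        unfolding c_def by (rule order_trans[OF norm_triangle_ineq2])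
      ultimately show "(LINT t|lborel. norm (f' t) * min 2 (8 * e * \<bar>t\<bar>)) < norm (LINT t|lborel. f' t)"
        using r(2) by linarith
    qed
    moreover have "conv u' (fejer 0 e) x = cis (- (\<xi> * x)) * conv u (fejer \<xi> e) x"
    proof -
      have "cis (- (\<xi> * (x - t))) = cis (- (\<xi> * x)) * cis (\<xi> * t)" for t
        by (simp add: cis_mult algebra_simps)
      then have "u' (x - t) * fejer 0 e t = cis (- (\<xi> * x)) * (u (x - t) * fejer \<xi> e t)" for t
        unfolding u'_def fejer_def by (simp add: mult_ac)
      then show ?thesis by (simp add: conv_def)
    qed
    ultimately show ?thesis by (simp add: cis_neq_zero)
  qed
  then show ?thesis using r(1) by blast
qed

text \<open>Bisection: by the doubling formula, a Fejer mean of width \<open>e\<close> is a combination of three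
  means of half the width inside the same frequency interval.\<close>

lemma conv_fejer_eq_0_if_locally:
  fixes u :: "real \<Rightarrow> complex"
  assumes u: "u \<in> borel_measurable borel" and C: "\<And>y. norm (u y) \<le> C"
    and loc: "\<And>\<xi>0. \<exists>r>0. \<forall>\<xi> e x. \<bar>\<xi> - \<xi>0\<bar> < r \<and> 0 < e \<and> e < r \<longrightarrow> conv u (fejer \<xi> e) x = 0"
    and e: "e > 0"
  shows "conv u (fejer \<xi> e) x = 0"
proof -
  obtain r where r: "\<And>\<xi>0. r \<xi>0 > 0"
    and rz: "\<And>\<xi>0 \<xi> e x. \<bar>\<xi> - \<xi>0\<bar> < r \<xi>0 \<Longrightarrow> 0 < e \<Longrightarrow> e < r \<xi>0 \<Longrightarrow> conv u (fejer \<xi> e) x = 0"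
    using loc by metis
  \<comment> \<open>This is the frequency interval of the kernel. Compactness leaves finitely many
    local radii, so that one width bound \<open>\<epsilon>\<close> serves all centres in it.\<close>
  define a b where "a = \<xi> - 2 * e" and "b = \<xi> + 2 * e"
  obtain A where A: "A \<subseteq> {a..b}" "finite A" "{a..b} \<subseteq> (\<Union>c\<in>A. ball c (r c))"
    by (rule compactE_image[of "{a..b}" "{a..b}" "\<lambda>c. ball c (r c)"]) (auto simp: r)
  have "a \<in> {a..b}" using e by (simp add: a_def b_def)
  then have Ane: "A \<noteq> {}" using A(3) by auto
  define \<epsilon> where "\<epsilon> = Min (r ` A)"
  have \<epsilon>: "\<epsilon> > 0" using A(2) Ane r by (auto simp: \<epsilon>_def)
  have fine: "conv u (fejer \<xi>' e') x = 0" if e': "\<xi>' \<in> {a..b}" "0 < e'" "e' < \<epsilon>" for \<xi>' e' x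
  proof -
    obtain c where c: "c \<in> A" "\<xi>' \<in> ball c (r c)" using e'(1) A(3) by blast
    have "\<epsilon> \<le> r c" unfolding \<epsilon>_def using A(2) c(1) by auto
    then show ?thesis
      using rz[of \<xi>' c e' x] c(2) e' by (auto simp: dist_real_def abs_minus_commute)
  qed
  \<comment> \<open>The whole frequency interval, not just its centre, has to stay in [a, b]. The
    halves, centred at \<open>\<xi>'\<close> and at distance \<open>e'\<close> on either side, still
    reach at most \<open>2 * e'\<close> away from \<open>\<xi>'\<close>, so the invariant is
    inherited.\<close>
  have "conv u (fejer \<xi>' e') x = 0"
    if "0 < e'" "e' < 2 ^ n * \<epsilon>" "a \<le> \<xi>' - 2 * e'" "\<xi>' + 2 * e' \<le> b" for n \<xi>' e' x
    using that
  proof (induction n arbitrary: \<xi>' e')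
    case 0
    then show ?case by (intro fine) auto
  next
    case (Suc n)
    have z: "conv u (fejer \<xi>' (e' / 2)) x = 0" "conv u (fejer (\<xi>' + e') (e' / 2)) x = 0"
      "conv u (fejer (\<xi>' - e') (e' / 2)) x = 0"
      using Suc.prems by (intro Suc.IH; simp)+
    have i: "integrable lborel (\<lambda>y. u (x - y) * fejer \<zeta> (e' / 2) y)" for \<zeta>
      using Suc.prems by (intro integrable_conv[OF u C] integrable_fejer) auto
    have "conv u (fejer \<xi>' e') x = (LINT y|lborel. (2 * (u (x - y) * fejer \<xi>' (e' / 2) y)
        + u (x - y) * fejer (\<xi>' + e') (e' / 2) y + u (x - y) * fejer (\<xi>' - e') (e' / 2) y) / 4)"
      unfolding conv_def by (subst fejer_double) (simp add: algebra_simps add_divide_distrib)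
    also have "\<dots> = (2 * conv u (fejer \<xi>' (e' / 2)) x + conv u (fejer (\<xi>' + e') (e' / 2)) x
        + conv u (fejer (\<xi>' - e') (e' / 2)) x) / 4"
      unfolding conv_def using i by simp
    finally show ?case by (simp add: z)
  qed
  moreover obtain n where "e < 2 ^ n * \<epsilon>"
    using real_arch_pow[of 2 "e / \<epsilon>"] \<epsilon> by (auto simp: pos_divide_less_eq)
  ultimately show ?thesis
    using e by (auto simp: a_def b_def)
qed

section \<open>Recovering a continuous function from its Fejer means, and the scalar
  expansion\<close>

lemma integral_sinc_sq_pos: "(LINT z|lborel. (sinc z)\<^sup>2) > 0"
proof (rule ccontr)
  assume "\<not> ?thesis"
  moreover have "(LINT z|lborel. (sinc z)\<^sup>2) \<ge> 0"
    by (intro Bochner_Integration.integral_nonneg) simp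
  ultimately have "(LINT z|lborel. (sinc z)\<^sup>2) = 0" by linarith
  then have "AE z in lborel. (sinc z)\<^sup>2 = 0"
    by (subst (asm) integral_nonneg_eq_0_iff_AE[OF integrable_sinc_sq]) auto
  then have "AE z in lborel. z \<notin> {0<..<1::real}"
  proof eventually_elim
    case (elim z)
    then have "z \<noteq> 0" "sin z = 0" by (auto split: if_splits)
    then show ?case using sin_gt_zero[of z] pi_gt3 by auto
  qed
  then have "{0<..<1::real} \<in> null_sets lborel"
    by (subst AE_iff_null_sets) auto
  then show False by (simp add: null_sets_def)
qed

text \<open>After rescaling, the kernels \<open>fejer 0 m\<close> for growing m form an approximate
  identity up to the positive integral of sinc squared. The vanishing means therefore tend to a
  nonzero multiple of D x.\<close>

lemma eq_0_if_conv_fejer_eq_0: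
  fixes D :: "real \<Rightarrow> complex"
  assumes D: "continuous_on UNIV D" and C: "\<And>y. norm (D y) \<le> C"
    and z: "\<And>e. e > 0 \<Longrightarrow> conv D (fejer 0 e) x = 0"
  shows "D x = 0"
proof -
  have [measurable]: "D \<in> borel_measurable borel"
    using D by (rule borel_measurable_continuous_onI)
  define \<theta> where "\<theta> y = complex_of_real ((sinc y)\<^sup>2)" for y
  have \<theta>i: "integrable lborel \<theta>"
    unfolding \<theta>_def by (intro integrable_of_real integrable_sinc_sq)
  have \<theta>m [measurable]: "\<theta> \<in> borel_measurable borel"
    using borel_measurable_integrable[OF \<theta>i] by simp
  have zero: "(LINT y|lborel. D (x - y / real (Suc n)) * \<theta> y) = 0" for n
  proof -
    define m where "m = real (Suc n)"
    have m: "m > 0" by (simp add: m_def)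
    have "conv D (fejer 0 m) x = (LINT y|lborel. D (x - y) * \<theta> (m * y))"
      by (simp add: conv_def fejer_def \<theta>_def)
    also have "\<dots> = (1 / m) *\<^sub>R (LINT y|lborel. D (x - y / m) * \<theta> y)"
      using m by (subst lborel_integral_real_affine[where c="1 / m" and t=0]) auto
    finally show ?thesis
      using z[OF m] m by (simp add: m_def del: of_nat_Suc)
  qed
  have "(\<lambda>n. LINT y|lborel. D (x - y / real (Suc n)) * \<theta> y) \<longlonglongrightarrow> (LINT y|lborel. D x * \<theta> y)"
  proof (rule integral_dominated_convergence)
    show "integrable lborel (\<lambda>y. C * norm (\<theta> y))" using \<theta>i by auto
    show "AE y in lborel. (\<lambda>n. D (x - y / real (Suc n)) * \<theta> y) \<longlonglongrightarrow> D x * \<theta> y"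
    proof (rule AE_I2)
      fix y
      have "(\<lambda>n. x - y * (1 / real (Suc n))) \<longlonglongrightarrow> x - y * 0"
        by (intro tendsto_intros LIMSEQ_Suc[OF lim_1_over_n])
      then have "(\<lambda>n. x - y / real (Suc n)) \<longlonglongrightarrow> x" by simp
      moreover have "isCont D x"
        using D by (simp add: continuous_on_eq_continuous_at)
      ultimately show "(\<lambda>n. D (x - y / real (Suc n)) * \<theta> y) \<longlonglongrightarrow> D x * \<theta> y"
        by (intro tendsto_intros isCont_tendsto_compose[of x D])
    qed
    show "AE y in lborel. norm (D (x - y / real (Suc n)) * \<theta> y) \<le> C * norm (\<theta> y)" for n
      by (intro AE_I2) (simp add: norm_mult mult_right_mono C)
  qed measurable
  then have "(LINT y|lborel. D x * \<theta> y) = 0"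
    unfolding zero using LIMSEQ_unique tendsto_const by blast
  moreover have "(LINT y|lborel. \<theta> y) = complex_of_real (LINT z|lborel. (sinc z)\<^sup>2)"
    unfolding \<theta>_def by (rule integral_of_real[OF integrable_sinc_sq])
  ultimately show ?thesis
    using integral_sinc_sq_pos \<theta>i by simp
qed

theorem kadec_expands_if_spectrum:
  fixes u :: "real \<Rightarrow> complex"
  assumes u: "continuous_on UNIV u" and C: "\<And>y. norm (u y) \<le> C"
    and \<gamma>: "0 < \<gamma>" "\<gamma> < \<eta>"
    and spec: "\<And>\<xi>. \<bar>\<xi>\<bar> > \<gamma> \<Longrightarrow> \<exists>f. integrable lborel f \<and> (\<forall>x. conv u f x = 0) \<and>
       (LINT t|lborel. f t * cis (- (\<xi> * t))) \<noteq> 0"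
  shows "kadec_expands \<eta> u"
  unfolding kadec_expands_def
proof (intro allI impI)
  fix x0 s :: real assume s: "\<bar>s\<bar> * \<eta> \<le> pi / 4"
  define d h where "d = s * \<eta> / pi" and "h = pi / \<eta>"
  have d: "\<bar>d\<bar> \<le> 1/4"
    using s \<gamma> by (simp add: d_def abs_mult divide_le_eq)
  have um [measurable]: "u \<in> borel_measurable borel"
    using u by (rule borel_measurable_continuous_onI)
  define w where "w k = \<bar>kadec_cos d k\<bar> + \<bar>kadec_sin d k\<bar>" for k
  have w: "summable w"
    unfolding w_def using sums_kadec_abs[OF d] by (rule sums_summable)
  have wC: "summable (\<lambda>k. w k * C)" using w by (rule summable_mult2)
  have tw: "norm (kadec_term d h u x k) \<le> w k * C" for x k
    unfolding w_def by (rule norm_kadec_term_le[OF C])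
  define K where "K x = (\<Sum>k. kadec_term d h u x k)" for x
  have unif: "uniform_limit UNIV (\<lambda>n x. \<Sum>k<n. kadec_term d h u x k) K sequentially"
    unfolding K_def by (rule Weierstrass_m_test[OF tw wC])
  have cK: "continuous_on UNIV K"
  proof (rule uniform_limit_theorem[OF _ unif])
    have "continuous_on UNIV (\<lambda>x. kadec_term d h u x k)" for k
      unfolding kadec_term_def by (intro continuous_intros continuous_on_compose2[OF u]) auto
    then show "\<forall>\<^sub>F n in sequentially. continuous_on UNIV (\<lambda>x. \<Sum>k<n. kadec_term d h u x k)"
      by (intro always_eventually allI continuous_on_sum)
  qed simp
  have Km [measurable]: "K \<in> borel_measurable borel"
    using cK by (rule borel_measurable_continuous_onI)
  have sk: "kadec_term d h u x sums K x" for x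
    unfolding K_def by (rule summable_sums[OF summable_comparison_test'[OF wC tw]])
  have K: "norm (K x) \<le> (\<Sum>k. w k * C)" for x
    by (rule norm_sums_le[OF sk summable_sums[OF wC] tw])
  define D where "D x = u (x + s) - u x - K x" for x
  have cD: "continuous_on UNIV D"
    unfolding D_def by (intro continuous_intros cK u continuous_on_compose2[OF u]) auto
  have DC: "norm (D x) \<le> C + C + (\<Sum>k. w k * C)" for x
    unfolding D_def
    by (intro order_trans[OF norm_triangle_ineq4] add_mono K C)
  \<comment> \<open>Convolution commutes with the expansion, so the mean of the defect D is the
    defect of the mean of u. It vanishes as soon as the mean of u either vanishes or has the
    expansion.\<close>
  have conv: "kadec_term d h (conv u (fejer \<xi> e)) x sums
      (conv u (fejer \<xi> e) (x + s) - conv u (fejer \<xi> e) x - conv D (fejer \<xi> e) x)" if e: "e > 0" for \<xi> e x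
  proof -
    note fi = integrable_fejer[OF e, of \<xi>]
    define \<Phi> where "\<Phi> y x = u (x - y) * fejer \<xi> e y" for y x
    have c: "(\<lambda>x. LINT y|lborel. \<Phi> y x) = conv u (fejer \<xi> e)"
      by (simp add: \<Phi>_def conv_def fun_eq_iff)
    have pint: "kadec_term d h (\<lambda>x. LINT y|lborel. \<Phi> y x) x sums
        (LINT y|lborel. (\<Sum>k. kadec_term d h (\<Phi> y) x k))"
    proof (rule kadec_term_integral_sums[OF _ _ _ d])
      show "integrable lborel (\<lambda>y. \<Phi> y x)" for x
        unfolding \<Phi>_def by (rule integrable_conv[OF um C fi])
      show "norm (\<Phi> y x) \<le> C * norm (fejer \<xi> e y)" for y x
        unfolding \<Phi>_def norm_mult by (intro mult_right_mono C) simp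
      show "(LINT y|lborel. norm (\<Phi> y x)) \<le> C * (LINT y|lborel. norm (fejer \<xi> e y))" for x
        unfolding \<Phi>_def by (rule integral_norm_conv_le[OF um C fi])
    qed
    have "kadec_term d h (\<Phi> y) x k = kadec_term d h u (x - y) k * fejer \<xi> e y" for y k
      unfolding \<Phi>_def kadec_term_mult_right kadec_term_shift ..
    then have "(\<Sum>k. kadec_term d h (\<Phi> y) x k) = K (x - y) * fejer \<xi> e y" for y
      unfolding K_def by (simp add: suminf_mult2[OF sums_summable[OF sk], symmetric])
    then have 1: "kadec_term d h (conv u (fejer \<xi> e)) x sums conv K (fejer \<xi> e) x"
      using pint unfolding c by (simp add: conv_def)
    have "conv D (fejer \<xi> e) x = (LINT y|lborel. u (x + s - y) * fejer \<xi> e y - u (x - y) * fejer \<xi> e y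
        - K (x - y) * fejer \<xi> e y)"
      unfolding conv_def D_def by (simp add: algebra_simps)
    also have "\<dots> = conv u (fejer \<xi> e) (x + s) - conv u (fejer \<xi> e) x - conv K (fejer \<xi> e) x"
      unfolding conv_def
      using integrable_conv[OF um C fi] integrable_conv[OF Km K fi] by simp
    finally show ?thesis using 1 by simp
  qed
  have "\<exists>r>0. \<forall>\<xi> e x. \<bar>\<xi> - \<xi>0\<bar> < r \<and> 0 < e \<and> e < r \<longrightarrow> conv D (fejer \<xi> e) x = 0" for \<xi>0
  proof (cases "\<bar>\<xi>0\<bar> > \<gamma>")
    case True
    then obtain f where f: "integrable lborel f" "\<And>x. conv u f x = 0"
      "(LINT t|lborel. f t * cis (- (\<xi>0 * t))) \<noteq> 0"
      using spec by blast
    obtain r where r: "r > 0"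
      "\<And>\<xi> e x. \<bar>\<xi> - \<xi>0\<bar> < r \<and> 0 < e \<and> e < r \<Longrightarrow> conv u (fejer \<xi> e) x = 0"
      using conv_fejer_eq_0_near[OF um C f] by blast
    have "conv D (fejer \<xi> e) x = 0" if a: "\<bar>\<xi> - \<xi>0\<bar> < r \<and> 0 < e \<and> e < r" for \<xi> e x
    proof -
      have z: "conv u (fejer \<xi> e) = (\<lambda>x. 0)" using r(2)[OF a] by auto
      show ?thesis
        using conv[of e \<xi> x] a unfolding z kadec_term_zero
        by (metis diff_0_right eq_iff_diff_eq_0 sums_unique2 sums_zero)
    qed
    then show ?thesis using r(1) by blast
  next
    case False
    \<comment> \<open>A third of the gap: |\<xi>| < \<gamma> + r and 2 e < 2 r together keep the
      kernel within \<eta>.\<close>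
    define r where "r = (\<eta> - \<gamma>) / 3"
    have "conv D (fejer \<xi> e) x = 0" if a: "\<bar>\<xi> - \<xi>0\<bar> < r \<and> 0 < e \<and> e < r" for \<xi> e x
    proof -
      have "\<bar>\<xi>\<bar> \<le> \<bar>\<xi>0\<bar> + \<bar>\<xi> - \<xi>0\<bar>" by linarith
      moreover have "3 * r = \<eta> - \<gamma>" by (simp add: r_def)
      ultimately have "\<bar>\<xi>\<bar> + 2 * e \<le> \<eta>" using a False by linarith
      then have "kadec_expands \<eta> (conv u (fejer \<xi> e))"
        using a by (intro kadec_expands_conv_fejer[OF um C]) auto
      then have "kadec_term d h (conv u (fejer \<xi> e)) x sums (conv u (fejer \<xi> e) (x + s) - conv u (fejer \<xi> e) x)"
        using s by (simp add: kadec_expands_def d_def h_def)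
      from sums_unique2[OF this conv] a show ?thesis by simp
    qed
    moreover have "r > 0" using \<gamma> by (simp add: r_def)
    ultimately show ?thesis by blast
  qed
  then have "conv D (fejer 0 e) x0 = 0" if "e > 0" for e
    using conv_fejer_eq_0_if_locally[OF borel_measurable_continuous_onI[OF cD] DC _ that] by blast
  then have "D x0 = 0"
    by (rule eq_0_if_conv_fejer_eq_0[OF cD DC])
  then show "kadec_term (s * \<eta> / pi) (pi / \<eta>) u x0 sums (u (x0 + s) - u x0)"
    using sk[of x0] by (simp add: D_def d_def h_def)
qed

section \<open>Perturbation of atomic decompositions\<close>

lemma scaleC_zero_right [simp]: "c *\<^sub>C (0::'a::complex_banach) = 0"
  using norm_scaleC[of c "0::'a"] by simp

lemma scaleC_zero_left [simp]: "0 *\<^sub>C (x::'a::complex_banach) = 0"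
  using norm_scaleC[of 0 x] by simp

lemma scaleC_one [simp]: "1 *\<^sub>C (x::'a::complex_banach) = x"
  using scaleC_of_real[of 1 x] by simp

lemma bounded_linear_scaleC: "bounded_linear (\<lambda>x::'a::complex_banach. c *\<^sub>C x)"
proof (rule bounded_linear_intro[where K="cmod c"])
  show "c *\<^sub>C (r *\<^sub>R x) = r *\<^sub>R c *\<^sub>C x" for r and x :: 'a
    unfolding scaleC_of_real[symmetric] scaleC_scaleC by (simp add: mult.commute)
qed (simp_all add: scaleC_add_right norm_scaleC)

lemma scaleC_diff_right: "c *\<^sub>C (x - y) = c *\<^sub>C x - c *\<^sub>C (y::'a::complex_banach)"
  using linear_diff[OF bounded_linear.linear[OF bounded_linear_scaleC]] .

lemma int_sums_unique: "int_sums f s \<Longrightarrow> int_sums f t \<Longrightarrow> s = t"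
  unfolding int_sums_def by (metis sums_unique2)

lemma int_sums_add: "int_sums f s \<Longrightarrow> int_sums g t \<Longrightarrow> int_sums (\<lambda>n. f n + g n) (s + t)"
proof -
  assume "int_sums f s" "int_sums g t"
  then obtain a b c d where
    "(\<lambda>n. f (int n)) sums a" "(\<lambda>n. f (- int (Suc n))) sums b" "s = a + b"
    "(\<lambda>n. g (int n)) sums c" "(\<lambda>n. g (- int (Suc n))) sums d" "t = c + d"
    unfolding int_sums_def by blast
  then show ?thesis
    unfolding int_sums_def
    by (intro exI[of _ "a + c"] exI[of _ "b + d"] conjI sums_add) (simp_all add: algebra_simps)
qed

lemma int_sums_bounded_linear:
  assumes "bounded_linear h" "int_sums f s"
  shows "int_sums (\<lambda>n. h (f n)) (h s)"
proof -
  interpret bounded_linear h by fact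
  obtain a b where "(\<lambda>n. f (int n)) sums a" "(\<lambda>n. f (- int (Suc n))) sums b" "s = a + b"
    using assms(2) unfolding int_sums_def by blast
  then show ?thesis
    unfolding int_sums_def by (intro exI[of _ "h a"] exI[of _ "h b"] conjI sums) (simp_all add: add)
qed

text \<open>The negative half of a two-sided series starts at -1, so n terms of each half fill an
  interval open on the right.\<close>

lemma sum_int_split:
  "(\<Sum>i<n. f (int i)) + (\<Sum>i<n. f (- int (Suc i))) = (\<Sum>i\<in>{- int n..<int n}. f i)"
proof -
  have "(\<Sum>i<n. f (int i)) = (\<Sum>i\<in>{0..<int n}. f i)"
    by (rule sum.reindex_bij_witness[of _ nat int]) auto
  moreover have "(\<Sum>i<n. f (- int (Suc i))) = (\<Sum>i\<in>{- int n..<0}. f i)"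
    by (rule sum.reindex_bij_witness[of _ "\<lambda>i. nat (- i - 1)" "\<lambda>i. - int (Suc i)"]) auto
  moreover have "{- int n..<0} \<union> {0..<int n} = {- int n..<int n}" by auto
  ultimately show ?thesis
    using sum.union_disjoint[of "{- int n..<0}" "{0..<int n}" f] by (simp add: add.commute)
qed

lemma int_sums_tendsto:
  assumes "int_sums f s"
  shows "(\<lambda>n. \<Sum>i\<in>{- int n..<int n}. f i) \<longlonglongrightarrow> s"
  using assms unfolding int_sums_def sums_def sum_int_split[symmetric]
  by (auto intro: tendsto_add)

lemma int_sums_finite:
  fixes f :: "int \<Rightarrow> 'a::real_normed_vector"
  assumes F: "finite F" and f: "\<And>n. n \<notin> F \<Longrightarrow> f n = 0"
  shows "int_sums f (\<Sum>n\<in>F. f n)"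
proof -
  define N where "N = nat (Max (insert 0 (abs ` F))) + 1"
  have N: "\<bar>i\<bar> < int N" if "i \<in> F" for i
  proof -
    have "\<bar>i\<bar> \<le> Max (insert 0 (abs ` F))" using F that by (intro Max_ge) auto
    moreover have "0 \<le> Max (insert 0 (abs ` F))" using F by (intro Max_ge) auto
    ultimately show ?thesis by (simp add: N_def)
  qed
  have "(\<lambda>n. f (int n)) sums (\<Sum>n<N. f (int n))"
    by (rule sums_finite) (use N in \<open>force intro!: f\<close>)+
  moreover have "(\<lambda>n. f (- int (Suc n))) sums (\<Sum>n<N. f (- int (Suc n)))"
    by (rule sums_finite) (use N in \<open>force intro!: f\<close>)+
  moreover have "(\<Sum>n\<in>F. f n) = (\<Sum>n<N. f (int n)) + (\<Sum>n<N. f (- int (Suc n)))"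
    unfolding sum_int_split
  proof (rule sum.mono_neutral_left)
    show "F \<subseteq> {- int N..<int N}" using N by fastforce
  qed (auto simp: f)
  ultimately show ?thesis unfolding int_sums_def by blast
qed

text \<open>Estimates are made on finite index sets, where no convergence is at stake; their
  validity for all finite sets is what later forces convergence.\<close>

definition fin_lp_norm :: "real \<Rightarrow> int set \<Rightarrow> (int \<Rightarrow> complex) \<Rightarrow> real" where
  "fin_lp_norm p F c = (\<Sum>n\<in>F. cmod (c n) powr p) powr (1 / p)"

lemma fin_lp_norm_nonneg [simp]: "0 \<le> fin_lp_norm p F c"
  by (simp add: fin_lp_norm_def)

lemma fin_lp_norm_scale_le:
  assumes p: "p \<ge> 1" and l: "l \<ge> 0" and le: "\<And>n. n \<in> F \<Longrightarrow> cmod (a n) \<le> l * cmod (c n)"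
  shows "fin_lp_norm p F a \<le> l * fin_lp_norm p F c"
proof -
  have "(\<Sum>n\<in>F. cmod (a n) powr p) \<le> (\<Sum>n\<in>F. (l * cmod (c n)) powr p)"
    using p by (intro sum_mono powr_mono2 le) auto
  also have "\<dots> = l powr p * (\<Sum>n\<in>F. cmod (c n) powr p)"
    using l by (simp add: powr_mult sum_distrib_left)
  finally have "fin_lp_norm p F a \<le> (l powr p * (\<Sum>n\<in>F. cmod (c n) powr p)) powr (1 / p)"
    unfolding fin_lp_norm_def using p by (intro powr_mono2) (auto intro: sum_nonneg)
  also have "\<dots> = l * fin_lp_norm p F c"
    unfolding fin_lp_norm_def using p l by (simp add: powr_mult sum_nonneg powr_powr)
  finally show ?thesis .
qed

lemma fin_lp_norm_le_lp_norm:
  assumes "p \<ge> 1" "c \<in> lp p" "finite F"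
  shows "fin_lp_norm p F c \<le> lp_norm p c"
  unfolding fin_lp_norm_def lp_norm_def
  using assms by (intro powr_mono2 finite_sum_le_infsum) (auto simp: lp_def intro: sum_nonneg)

lemma
  assumes "finite F" "\<And>n. n \<notin> F \<Longrightarrow> c n = 0"
  shows finite_support_in_lp: "c \<in> lp p"
    and lp_norm_finite_support: "lp_norm p c = fin_lp_norm p F c"
proof -
  have h: "((\<lambda>n. cmod (c n) powr p) has_sum (\<Sum>n\<in>F. cmod (c n) powr p)) UNIV"
    by (rule has_sum_finite_neutralI[OF assms(1)]) (auto simp: assms(2))
  show "c \<in> lp p" unfolding lp_def using h by (auto simp: summable_on_def)
  show "lp_norm p c = fin_lp_norm p F c"
    unfolding lp_norm_def fin_lp_norm_def infsumI[OF h] ..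
qed

lemma lp_norm_scale:
  assumes p: "p \<ge> 1" and c: "c \<in> lp p" and l: "l \<ge> 0"
  shows "(\<lambda>n. of_real l * c n) \<in> lp p" "lp_norm p (\<lambda>n. of_real l * c n) = l * lp_norm p c"
proof -
  have "((\<lambda>n. cmod (c n) powr p) has_sum (\<Sum>\<^sub>\<infinity>n. cmod (c n) powr p)) UNIV"
    using c by (simp add: lp_def)
  from has_sum_cmult_right[OF this, of "l powr p"]
  have h: "((\<lambda>n. cmod (of_real l * c n) powr p) has_sum (l powr p * (\<Sum>\<^sub>\<infinity>n. cmod (c n) powr p))) UNIV"
    using l by (simp add: norm_mult powr_mult)
  show "(\<lambda>n. of_real l * c n) \<in> lp p" unfolding lp_def using h by (auto simp: summable_on_def)
  show "lp_norm p (\<lambda>n. of_real l * c n) = l * lp_norm p c"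
    unfolding lp_norm_def infsumI[OF h] using p l
    by (simp add: powr_mult powr_powr infsum_nonneg)
qed

section \<open>Norm bounds for the synthesis operator and convergence criteria\<close>

lemma synthesis_eq: "int_sums (\<lambda>n. c n *\<^sub>C X n) s \<Longrightarrow> synthesis X c = s"
  unfolding synthesis_def by (rule the_equality) (auto intro: int_sums_unique)

lemma
  fixes X :: "int \<Rightarrow> 'a::complex_banach"
  assumes p: "p \<ge> 1" and X: "synthesis_bounded p X"
  shows synthesis_norm_nonneg: "synthesis_norm p X \<ge> 0"
    and norm_synthesis_le: "c \<in> lp p \<Longrightarrow> norm (synthesis X c) \<le> synthesis_norm p X * lp_norm p c"
proof -
  obtain K where K: "\<And>c. c \<in> lp p \<Longrightarrow> norm (synthesis X c) \<le> K * lp_norm p c"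
    using X by (auto simp: synthesis_bounded_def)
  define U where "U = {c \<in> lp p. lp_norm p c \<le> 1}"
  have ln: "lp_norm p c \<ge> 0" for c by (simp add: lp_norm_def)
  have bd: "bdd_above ((\<lambda>c. norm (synthesis X c)) ` U)"
  proof (rule bdd_aboveI2)
    fix c assume c: "c \<in> U"
    have "norm (synthesis X c) \<le> K * lp_norm p c" using K c by (auto simp: U_def)
    also have "\<dots> \<le> \<bar>K\<bar> * 1" using c ln by (intro mult_mono) (auto simp: U_def)
    finally show "norm (synthesis X c) \<le> \<bar>K\<bar>" by simp
  qed
  have up: "norm (synthesis X c) \<le> synthesis_norm p X" if "c \<in> U" for c
    unfolding synthesis_norm_def U_def[symmetric] by (rule cSUP_upper[OF that bd])
  have "(\<lambda>n. 0) \<in> U"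
    using finite_support_in_lp[where F="{}" and c="\<lambda>n. 0" and p=p]
      lp_norm_finite_support[where F="{}" and c="\<lambda>n. 0" and p=p]
    by (simp add: U_def fin_lp_norm_def)
  from up[OF this] show "synthesis_norm p X \<ge> 0" using norm_ge_zero order_trans by blast
  assume c: "c \<in> lp p"
  show "norm (synthesis X c) \<le> synthesis_norm p X * lp_norm p c"
  \<comment> \<open>A sequence of norm 0 cannot be normalised; for it the constant K from
    \<open>synthesis_bounded\<close> already gives synthesis 0.\<close>
  proof (cases "lp_norm p c = 0")
    case True
    then show ?thesis using K[OF c] by simp
  next
    case False
    define l where "l = 1 / lp_norm p c"
    have l: "l > 0" using False ln[of c] by (simp add: l_def)
    obtain s where s: "int_sums (\<lambda>n. c n *\<^sub>C X n) s"
      using X c by (auto simp: synthesis_bounded_def)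
    have "int_sums (\<lambda>n. l *\<^sub>R (c n *\<^sub>C X n)) (l *\<^sub>R s)"
      by (rule int_sums_bounded_linear[OF bounded_linear_scaleR_right s])
    then have "int_sums (\<lambda>n. (of_real l * c n) *\<^sub>C X n) (l *\<^sub>R s)"
      by (simp add: scaleC_of_real[symmetric] scaleC_scaleC)
    then have "synthesis X (\<lambda>n. of_real l * c n) = l *\<^sub>R s" by (rule synthesis_eq)
    moreover have "(\<lambda>n. of_real l * c n) \<in> U"
      using lp_norm_scale[OF p c, of l] l False by (simp add: U_def l_def)
    ultimately have "l * norm s \<le> synthesis_norm p X"
      using up[of "\<lambda>n. of_real l * c n"] l by simp
    then show ?thesis
      using synthesis_eq[OF s] l False ln[of c] by (simp add: l_def pos_divide_le_eq)
  qed
qed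

lemma norm_sum_scaleC_le_synthesis_norm:
  fixes X :: "int \<Rightarrow> 'a::complex_banach"
  assumes p: "p \<ge> 1" and X: "synthesis_bounded p X" and F: "finite F"
  shows "norm (\<Sum>n\<in>F. c n *\<^sub>C X n) \<le> synthesis_norm p X * fin_lp_norm p F c"
proof -
  define c' where "c' n = (if n \<in> F then c n else 0)" for n
  have c': "c' n = 0" if "n \<notin> F" for n using that by (simp add: c'_def)
  have "int_sums (\<lambda>n. c' n *\<^sub>C X n) (\<Sum>n\<in>F. c' n *\<^sub>C X n)"
    by (rule int_sums_finite[OF F]) (simp add: c')
  then have "synthesis X c' = (\<Sum>n\<in>F. c' n *\<^sub>C X n)" by (rule synthesis_eq)
  also have "\<dots> = (\<Sum>n\<in>F. c n *\<^sub>C X n)" by (simp add: c'_def)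
  finally show ?thesis
    using norm_synthesis_le[OF p X finite_support_in_lp[where c=c', OF F c']]
      lp_norm_finite_support[where c=c' and p=p, OF F c']
    by (simp add: fin_lp_norm_def c'_def)
qed

lemma summable_if_lp_dominated:
  fixes f :: "nat \<Rightarrow> 'a::banach"
  assumes p: "p \<ge> 1" and N: "N \<ge> 0" and r: "summable r" "\<And>n. r n \<ge> 0"
    and le: "\<And>m n. norm (sum f {m..<n}) \<le> N * (sum r {m..<n}) powr (1 / p)"
  shows "summable f"
  unfolding summable_Cauchy
proof (intro allI impI)
  fix e :: real assume e: "e > 0"
  \<comment> \<open>Chosen so that N times its p-th root is N e / (N + 1), which is below e; the 1
    covers N = 0.\<close>
  define e' where "e' = (e / (N + 1)) powr p"
  have e': "e' > 0" using e N by (simp add: e'_def)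
  obtain M where M: "\<And>m n. m \<ge> M \<Longrightarrow> norm (sum r {m..<n}) < e'"
    using r(1) e' unfolding summable_Cauchy by blast
  have "norm (sum f {m..<n}) < e" if "m \<ge> M" for m n
  proof -
    have s: "0 \<le> sum r {m..<n}" using r(2) by (intro sum_nonneg)
    have "(sum r {m..<n}) powr (1 / p) \<le> e' powr (1 / p)"
      using M[OF that, of n] s p by (intro powr_mono2) auto
    also have "\<dots> = e / (N + 1)"
      using e N p by (simp add: e'_def powr_powr)
    finally have "norm (sum f {m..<n}) \<le> N * (e / (N + 1))"
      by (rule order_trans[OF le mult_left_mono[OF _ N]])
    also have "\<dots> < e" using e N by (simp add: field_simps)
    finally show ?thesis .
  qed
  then show "\<exists>M. \<forall>m\<ge>M. \<forall>n. norm (sum f {m..<n}) < e" by blast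
qed

text \<open>A bound on all finite sums controls the blocks of each one-sided series by tails of a
  summable series, so both are Cauchy. The norm bound is taken from the two-sided partial sums,
  hence no factor 2 for the two halves.\<close>

lemma int_sums_if_lp_dominated:
  fixes e :: "int \<Rightarrow> 'a::banach"
  assumes p: "p \<ge> 1" and N: "N \<ge> 0" and c: "c \<in> lp p"
    and le: "\<And>F. finite F \<Longrightarrow> norm (\<Sum>n\<in>F. e n) \<le> N * fin_lp_norm p F c"
  shows "\<exists>s. int_sums e s \<and> norm s \<le> N * lp_norm p c"
proof -
  have summ: "summable (\<lambda>n. e (h n))" if h: "inj h" for h :: "nat \<Rightarrow> int"
  proof (rule summable_if_lp_dominated[OF p N, where r="\<lambda>n. cmod (c (h n)) powr p"])
    have "(\<lambda>n. cmod (c n) powr p) summable_on UNIV"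
      using c by (simp add: lp_def)
    then have "(\<lambda>n. cmod (c n) powr p) summable_on range h"
      by (rule summable_on_subset_banach) simp
    then have "((\<lambda>n. cmod (c n) powr p) \<circ> h) summable_on UNIV"
      by (simp only: summable_on_reindex[OF h])
    then show "summable (\<lambda>n. cmod (c (h n)) powr p)"
      by (auto simp: o_def intro: summable_on_imp_summable)
    fix m n :: nat
    have inj: "inj_on h {m..<n}" using h by (rule inj_on_subset) simp
    have "norm (\<Sum>i\<in>h ` {m..<n}. e i) \<le> N * fin_lp_norm p (h ` {m..<n}) c"
      by (rule le) simp
    then show "norm (\<Sum>i = m..<n. e (h i)) \<le> N * (\<Sum>i = m..<n. cmod (c (h i)) powr p) powr (1 / p)"
      unfolding fin_lp_norm_def sum.reindex[OF inj] by (simp add: o_def)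
  qed simp
  have "summable (\<lambda>n. e (int n))" "summable (\<lambda>n. e (- int (Suc n)))"
    using summ[of int] summ[of "\<lambda>n. - int (Suc n)"] by (simp_all add: inj_def)
  then have s: "int_sums e ((\<Sum>n. e (int n)) + (\<Sum>n. e (- int (Suc n))))" (is "int_sums e ?s")
    unfolding int_sums_def
    by (intro exI[of _ "\<Sum>n. e (int n)"] exI[of _ "\<Sum>n. e (- int (Suc n))"] conjI refl)
      (simp_all only: summable_sums)
  have "norm ?s \<le> N * lp_norm p c"
  proof (rule tendsto_upperbound[OF tendsto_norm[OF int_sums_tendsto[OF s]]])
    have "norm (\<Sum>i\<in>{- int n..<int n}. e i) \<le> N * lp_norm p c" for n
      by (rule order_trans[OF le mult_left_mono[OF fin_lp_norm_le_lp_norm[OF p c] N]]) simp_all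
    then show "\<forall>\<^sub>F n in sequentially. norm (\<Sum>i\<in>{- int n..<int n}. e i) \<le> N * lp_norm p c"
      by simp
  qed simp
  with s show ?thesis by blast
qed

text \<open>\<open>G y\<close> is the fixed point of the contraction sending v to y - R v;
  uniqueness of the fixed point gives additivity and homogeneity of G.\<close>

lemma bounded_clinear_inverse_near_id:
  fixes R :: "'a::complex_banach \<Rightarrow> 'a"
  assumes R: "bounded_clinear R" and le: "\<And>v. norm (R v) \<le> q * norm v" and q: "0 \<le> q" "q < 1"
  obtains G where "bounded_clinear G" "\<And>v. G (v + R v) = v" "\<And>v. G v + R (G v) = v"
proof -
  define S where "S v = v + R v" for v
  have Rl: "bounded_linear R" and Rc: "R (c *\<^sub>C v) = c *\<^sub>C R v" for c v
    using R by (auto simp: bounded_clinear_def)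
  interpret R: bounded_linear R by (rule Rl)
  have ex: "\<exists>!v. S v = y" for y
  proof -
    have "\<exists>!v. y - R v = v"
    proof (rule banach_fix_type[OF q], intro allI)
      show "dist (y - R v) (y - R w) \<le> q * dist v w" for v w
        using le[of "w - v"] by (simp add: dist_norm R.diff norm_minus_commute)
    qed
    then show ?thesis by (simp add: S_def algebra_simps eq_commute[of y] diff_eq_eq)
  qed
  define G where "G y = (THE v. S v = y)" for y
  have SG: "S (G y) = y" for y unfolding G_def by (rule theI'[OF ex])
  have uniq: "G y = v" if "S v = y" for v y using ex[of y] SG that by blast
  have lower: "(1 - q) * norm (G y) \<le> norm y" for y
  proof -
    have "norm (G y) \<le> norm (S (G y)) + norm (R (G y))"
      unfolding S_def using norm_triangle_ineq4[of "G y + R (G y)" "R (G y)"] by simp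
    then show ?thesis using le[of "G y"] by (simp add: SG algebra_simps)
  qed
  have "bounded_linear G"
  proof (rule bounded_linear_intro[where K="1 / (1 - q)"])
    show "G (x + y) = G x + G y" for x y
      by (rule uniq) (use SG[of x] SG[of y] in \<open>simp add: S_def R.add algebra_simps\<close>)
    show "G (r *\<^sub>R x) = r *\<^sub>R G x" for r x
    proof (rule uniq)
      have "S (r *\<^sub>R G x) = r *\<^sub>R S (G x)" by (simp add: S_def R.scaleR scaleR_add_right)
      then show "S (r *\<^sub>R G x) = r *\<^sub>R x" by (simp add: SG)
    qed
    show "norm (G y) \<le> norm y * (1 / (1 - q))" for y
      using lower[of y] q by (simp add: pos_le_divide_eq mult.commute)
  qed
  moreover have "G (c *\<^sub>C x) = c *\<^sub>C G x" for c x
  proof (rule uniq)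
    have "S (c *\<^sub>C G x) = c *\<^sub>C S (G x)" by (simp add: S_def Rc scaleC_add_right)
    then show "S (c *\<^sub>C G x) = c *\<^sub>C x" by (simp add: SG)
  qed
  ultimately have "bounded_clinear G" by (simp add: bounded_clinear_def)
  moreover have "G (v + R v) = v" for v by (rule uniq) (simp add: S_def)
  moreover have "G v + R (G v) = v" for v using SG[of v] by (simp add: S_def)
  ultimately show ?thesis by (rule that)
qed

text \<open>N bounds synthesis with the differences W n - X n and B bounds analysis by Y, so the
  perturbation R of the identity has norm at most B N. The new bounds arise because the inverse of
  id + R changes norms by a factor between inverse (1 + B N) and inverse (1 - B N).\<close>

theorem atomic_decomposition_perturbation:
  fixes X W :: "int \<Rightarrow> 'a::complex_banach"
  assumes p: "p \<ge> 1" and A: "A > 0" and BA: "B \<ge> A" and XY: "atomic_decomposition p Y X A B"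
    and N: "N \<ge> 0" and small: "B * N < 1"
    and le: "\<And>F c. finite F \<Longrightarrow> norm (\<Sum>n\<in>F. c n *\<^sub>C (W n - X n)) \<le> N * fin_lp_norm p F c"
  shows "(\<exists>Z. atomic_decomposition p Z W (A * inverse (1 + B * N)) (B * inverse (1 - B * N))) \<and>
         (schauder_basis X \<longrightarrow> schauder_basis W)"
proof -
  have B: "B > 0" using A BA by linarith
  have Ycl: "bounded_clinear (Y n)" and Ylp: "(\<lambda>n. Y n v) \<in> lp p"
    and Yl: "A * norm v \<le> lp_norm p (\<lambda>n. Y n v)" and Yu: "lp_norm p (\<lambda>n. Y n v) \<le> B * norm v"
    and Ys: "int_sums (\<lambda>n. Y n v *\<^sub>C X n) v" for n v
    using XY by (auto simp: atomic_decomposition_def)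
  have Ybl: "bounded_linear (Y n)" and Yc: "Y n (c *\<^sub>C v) = c * Y n v" for n c v
    using Ycl[of n] by (auto simp: bounded_clinear_def scaleC_complex_def)
  have "\<exists>s. int_sums (\<lambda>n. Y n v *\<^sub>C (W n - X n)) s \<and> norm s \<le> N * lp_norm p (\<lambda>n. Y n v)" for v
    by (rule int_sums_if_lp_dominated[OF p N Ylp le])
  then obtain R where R: "\<And>v. int_sums (\<lambda>n. Y n v *\<^sub>C (W n - X n)) (R v)"
    and RN: "\<And>v. norm (R v) \<le> N * lp_norm p (\<lambda>n. Y n v)"
    using choice[of "\<lambda>v s. int_sums (\<lambda>n. Y n v *\<^sub>C (W n - X n)) s \<and> norm s \<le> N * lp_norm p (\<lambda>n. Y n v)"]
    by auto
  have Rle: "norm (R v) \<le> B * N * norm v" for v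
    using order_trans[OF RN mult_left_mono[OF Yu N]] by (simp add: mult_ac)
  have Rc: "R (c *\<^sub>C v) = c *\<^sub>C R v" for c v
  proof (rule int_sums_unique[OF R])
    show "int_sums (\<lambda>n. Y n (c *\<^sub>C v) *\<^sub>C (W n - X n)) (c *\<^sub>C R v)"
      using int_sums_bounded_linear[OF bounded_linear_scaleC R, of c v] by (simp add: scaleC_scaleC Yc)
  qed
  have Rcl: "bounded_clinear R"
    unfolding bounded_clinear_def
  proof (intro conjI allI Rc bounded_linear_intro[where K="B * N"])
    show "R (v + w) = R v + R w" for v w
    proof (rule int_sums_unique[OF R])
      show "int_sums (\<lambda>n. Y n (v + w) *\<^sub>C (W n - X n)) (R v + R w)"
        using int_sums_add[OF R R, of v w]
        by (simp add: linear_add[OF bounded_linear.linear[OF Ybl]] scaleC_add_left)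
    qed
    show "R (r *\<^sub>R v) = r *\<^sub>R R v" for r v
      using Rc[of "of_real r" v] by (simp add: scaleC_of_real)
    show "norm (R v) \<le> norm v * (B * N)" for v
      using Rle[of v] by (simp add: mult_ac)
  qed
  have BN: "0 \<le> B * N" using B N by simp
  obtain G where G: "bounded_clinear G" and GS: "\<And>v. G (v + R v) = v" and SG: "\<And>v. G v + R (G v) = v"
    using bounded_clinear_inverse_near_id[OF Rcl Rle BN small] by blast
  have Gbl: "bounded_linear G" and Gc: "G (c *\<^sub>C v) = c *\<^sub>C G v" for c v
    using G by (auto simp: bounded_clinear_def)
  have SW: "int_sums (\<lambda>n. Y n v *\<^sub>C W n) (v + R v)" for v
    using int_sums_add[OF Ys R, of v v] by (simp add: scaleC_diff_right)
  define Z where "Z n v = Y n (G v)" for n v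
  have Zs: "int_sums (\<lambda>n. Z n v *\<^sub>C W n) v" for v
    using SW[of "G v"] by (simp add: Z_def SG)
  have Gup: "norm (G v) \<le> inverse (1 - B * N) * norm v" for v
  proof -
    have "G v = v - R (G v)"
      using SG[of v] by (simp add: eq_diff_eq)
    then have "norm (G v) \<le> norm v + norm (R (G v))"
      using norm_triangle_ineq4[of v "R (G v)"] by simp
    then have "(1 - B * N) * norm (G v) \<le> norm v"
      using Rle[of "G v"] by (simp add: algebra_simps)
    then show ?thesis using small by (simp add: field_simps)
  qed
  have Glow: "inverse (1 + B * N) * norm v \<le> norm (G v)" for v
  proof -
    have "norm v \<le> norm (G v) + norm (R (G v))"
      using norm_triangle_ineq[of "G v" "R (G v)"] by (simp add: SG)
    then have "norm v \<le> (1 + B * N) * norm (G v)"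
      using Rle[of "G v"] by (simp add: algebra_simps)
    then show ?thesis using BN by (simp add: field_simps)
  qed
  have "atomic_decomposition p Z W (A * inverse (1 + B * N)) (B * inverse (1 - B * N))"
    unfolding atomic_decomposition_def
  proof (intro conjI allI Zs)
    show "bounded_clinear (Z n)" for n
      unfolding bounded_clinear_def Z_def
      using bounded_linear_compose[OF Ybl Gbl] by (simp add: Gc Yc scaleC_complex_def)
    show "(\<lambda>n. Z n v) \<in> lp p" for v unfolding Z_def by (rule Ylp)
    show "A * inverse (1 + B * N) * norm v \<le> lp_norm p (\<lambda>n. Z n v)" for v
      unfolding Z_def using order_trans[OF mult_left_mono[OF Glow, of A] Yl] A by (simp add: mult.assoc)
    show "lp_norm p (\<lambda>n. Z n v) \<le> B * inverse (1 - B * N) * norm v" for v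
      unfolding Z_def using order_trans[OF Yu mult_left_mono[OF Gup, of B]] B by (simp add: mult.assoc)
  qed
  moreover have "schauder_basis W" if basis: "schauder_basis X"
  proof -
    have uniq: "c = d" if "int_sums (\<lambda>n. c n *\<^sub>C X n) v" "int_sums (\<lambda>n. d n *\<^sub>C X n) v" for c d v
    proof -
      have ex1: "\<exists>!c. int_sums (\<lambda>n. c n *\<^sub>C X n) v" using basis by (simp add: schauder_basis_def)
      show ?thesis
        using the1_equality[OF ex1, OF that(1)] the1_equality[OF ex1, OF that(2)] by simp
    qed
    \<comment> \<open>In a basis the reproducing formula for \<open>X m\<close> must be its trivial
      expansion, so \<open>Y n (X m)\<close> is a Kronecker delta and id + R maps \<open>X m\<close>
      to \<open>W m\<close>. The inverse G then carries expansions in W to expansions in X, where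
      they are unique.\<close>
    have GW: "G (W m) = X m" for m
    proof -
      define \<delta> where "\<delta> n = (if n = m then 1 else 0 :: complex)" for n
      have d: "int_sums (\<lambda>n. \<delta> n *\<^sub>C V n) (V m)" for V :: "int \<Rightarrow> 'a"
        using int_sums_finite[of "{m}" "\<lambda>n. \<delta> n *\<^sub>C V n"] by (simp add: \<delta>_def)
      have "(\<lambda>n. Y n (X m)) = \<delta>"
        by (rule uniq[OF Ys d])
      then have "Y n (X m) = \<delta> n" for n by (rule fun_cong)
      then have "X m + R (X m) = W m"
        using SW[of "X m"] d[of W] by (auto intro: int_sums_unique)
      then show ?thesis using GS[of "X m"] by simp
    qed
    show ?thesis
      unfolding schauder_basis_def
    proof (intro allI ex_ex1I)
      show "\<exists>c. int_sums (\<lambda>n. c n *\<^sub>C W n) v" for v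
        using Zs[of v] by (intro exI[of _ "\<lambda>n. Z n v"])
      fix v c d assume "int_sums (\<lambda>n. c n *\<^sub>C W n) v" "int_sums (\<lambda>n. d n *\<^sub>C W n) v"
      from this[THEN int_sums_bounded_linear[OF Gbl]]
      have "int_sums (\<lambda>n. c n *\<^sub>C X n) (G v)" "int_sums (\<lambda>n. d n *\<^sub>C X n) (G v)"
        by (simp_all add: Gc GW)
      then show "c = d" by (rule uniq)
    qed
  qed
  ultimately show ?thesis by blast
qed

section \<open>Orbits of the representation\<close>

text \<open>The map is applied to the approximating simple functions. This takes the integral from a
  possibly nonseparable space to a separable one, turning annihilation of vectors into scalar
  identities.\<close>

lemma has_banach_integral_bounded_linear:
  fixes \<phi> :: "'a::banach \<Rightarrow> 'b::{banach, second_countable_topology}"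
  assumes \<phi>: "bounded_linear \<phi>" and f: "has_banach_integral M f w"
  shows "has_bochner_integral M (\<lambda>x. \<phi> (f x)) (\<phi> w)"
proof -
  interpret bounded_linear \<phi> by fact
  obtain s where fm: "f \<in> borel_measurable M"
    and s: "\<And>i. Bochner_Integration.simple_bochner_integrable M (s i)"
    and lim: "(\<lambda>i::nat. \<integral>\<^sup>+x. ennreal (norm (f x - s i x)) \<partial>M) \<longlonglongrightarrow> 0"
    and w: "(\<lambda>i. Bochner_Integration.simple_bochner_integral M (s i)) \<longlonglongrightarrow> w"
    using f unfolding has_banach_integral_def by blast
  obtain K where K: "K \<ge> 0" "\<And>x. norm (\<phi> x) \<le> norm x * K"
    using nonneg_bounded by metis
  have sf: "simple_function M (s i)" for i
    using s[of i] by (rule Bochner_Integration.simple_bochner_integrable.cases)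
  have \<phi>m: "\<phi> \<in> borel_measurable borel"
    by (intro borel_measurable_continuous_onI linear_continuous_on \<phi>)
  show ?thesis
  proof (rule has_bochner_integral.intros)
    show "(\<lambda>x. \<phi> (f x)) \<in> borel_measurable M"
      by (rule measurable_compose[OF fm \<phi>m])
    show "Bochner_Integration.simple_bochner_integrable M (\<lambda>x. \<phi> (s i x))" for i
      by (rule Bochner_Integration.simple_bochner_integrable_compose2[where p="\<lambda>x y. \<phi> x", OF zero s s])
    have "(\<lambda>i. Bochner_Integration.simple_bochner_integral M (\<lambda>x. \<phi> (s i x)))
        = (\<lambda>i. \<phi> (Bochner_Integration.simple_bochner_integral M (s i)))"
      by (intro ext Bochner_Integration.simple_bochner_integral_linear s linear_axioms)
    then show "(\<lambda>i. Bochner_Integration.simple_bochner_integral M (\<lambda>x. \<phi> (s i x))) \<longlonglongrightarrow> \<phi> w"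
      using tendsto[OF w] by simp
    have bound: "(\<integral>\<^sup>+x. ennreal (norm (\<phi> (f x) - \<phi> (s i x))) \<partial>M)
        \<le> ennreal K * (\<integral>\<^sup>+x. ennreal (norm (f x - s i x)) \<partial>M)" for i
    proof -
      have "(\<integral>\<^sup>+x. ennreal (norm (\<phi> (f x) - \<phi> (s i x))) \<partial>M)
          \<le> (\<integral>\<^sup>+x. ennreal K * ennreal (norm (f x - s i x)) \<partial>M)"
      proof (rule nn_integral_mono)
        fix x
        have "norm (\<phi> (f x) - \<phi> (s i x)) \<le> K * norm (f x - s i x)"
          using K(2)[of "f x - s i x"] unfolding diff by (simp only: mult.commute)
        then show "ennreal (norm (\<phi> (f x) - \<phi> (s i x))) \<le> ennreal K * ennreal (norm (f x - s i x))"
          unfolding ennreal_mult[OF K(1) norm_ge_zero, symmetric] by (rule ennreal_leI)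
      qed
      also have "\<dots> = ennreal K * (\<integral>\<^sup>+x. ennreal (norm (f x - s i x)) \<partial>M)"
      \<comment> \<open>A difference of Borel functions into a nonseparable space need not be Borel.
        But \<open>s i\<close> takes finitely many values c, and for each of them norm (y - c) is
        continuous in y.\<close>
      proof (rule nn_integral_cmult)
        have sc: "s i \<in> measurable M (count_space (s i ` space M))"
          using simple_functionD[OF sf] by (simp add: measurable_count_space_eq2)
        have "(\<lambda>y. norm (y - c)) \<in> borel_measurable borel" for c :: 'a
          by (intro borel_measurable_continuous_onI continuous_intros)
        note measurable_compose[OF measurable_compose[OF fm this] measurable_ennreal]
        then show "(\<lambda>x. ennreal (norm (f x - s i x))) \<in> borel_measurable M"
          by (rule measurable_compose_countable'[where f="\<lambda>c x. ennreal (norm (f x - c))", OF _ sc])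
            (rule countable_finite[OF simple_functionD(1)[OF sf]])
      qed
      finally show ?thesis .
    qed
    have "(\<lambda>i. ennreal K * (\<integral>\<^sup>+x. ennreal (norm (f x - s i x)) \<partial>M)) \<longlonglongrightarrow> ennreal K * 0"
      by (rule ennreal_tendsto_cmult[OF _ lim]) simp
    then show "(\<lambda>i. \<integral>\<^sup>+x. ennreal (norm (\<phi> (f x) - \<phi> (s i x))) \<partial>M) \<longlonglongrightarrow> 0"
      using tendsto_sandwich[OF always_eventually[OF allI[OF zero_le]] always_eventually[OF allI[OF bound]] tendsto_const]
      by simp
  qed
qed

text \<open>Annihilation is applied to the vector \<open>T x v\<close>: the group law turns
  \<open>T (- t)\<close> into \<open>T (x - t)\<close>, so the same f works at every point
  x.\<close>

lemma conv_matrix_coefficient_eq_0: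
  fixes T :: "real \<Rightarrow> 'a::complex_banach \<Rightarrow> 'a"
  assumes T: "line_representation T" and \<phi>: "bounded_clinear (\<phi> :: 'a \<Rightarrow> complex)"
    and f: "\<And>v. L1_action T f v 0"
  shows "conv (\<lambda>t. \<phi> (T t v)) f x = 0"
proof -
  have \<phi>l: "bounded_linear \<phi>" and \<phi>c: "\<phi> (c *\<^sub>C w) = c * \<phi> w" for c w
    using \<phi> by (auto simp: bounded_clinear_def scaleC_complex_def)
  have Tadd: "T (s + t) w = T s (T t w)" for s t w
    using T by (simp add: line_representation_def)
  have "has_bochner_integral lborel (\<lambda>t. \<phi> (f t *\<^sub>C T (- t) (T x v))) (\<phi> 0)"
    using f[of "T x v"] unfolding L1_action_def by (rule has_banach_integral_bounded_linear[OF \<phi>l])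
  moreover have "\<phi> (f t *\<^sub>C T (- t) (T x v)) = \<phi> (T (x - t) v) * f t" for t
    using Tadd[of "- t" x v] by (simp add: \<phi>c mult.commute)
  ultimately show ?thesis
    using linear_0[OF bounded_linear.linear[OF \<phi>l]]
    by (simp add: conv_def has_bochner_integral_integral_eq)
qed

text \<open>Norm convergence comes first, without knowledge of the limit, from the isometric orbit
  and the absolutely summable coefficients. The separating functionals then identify the limit
  through the scalar expansions.\<close>

lemma kadec_expands_orbit:
  fixes T :: "real \<Rightarrow> 'a::complex_banach \<Rightarrow> 'a" and Y :: "'i \<Rightarrow> 'a \<Rightarrow> complex"
  assumes T: "line_representation T" and iso: "isometric T" and sc: "strongly_continuous T"
    and spec: "Beurling_spectrum T \<subseteq> {-\<gamma>..\<gamma>}" and \<gamma>: "0 < \<gamma>" "\<gamma> < \<eta>"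
    and Y: "\<And>n. bounded_clinear (Y n)" and sep: "\<And>v. (\<And>n. Y n v = 0) \<Longrightarrow> v = 0"
  shows "kadec_expands \<eta> (\<lambda>t. T t v)"
proof -
  have Yl: "bounded_linear (Y n)" for n using Y[of n] by (simp add: bounded_clinear_def)
  have exY: "kadec_expands \<eta> (\<lambda>t. Y n (T t v))" for n v
  proof -
    obtain C where C: "\<And>w. norm (Y n w) \<le> norm w * C"
      using bounded_linear.bounded[OF Yl[of n]] by blast
    show ?thesis
    proof (rule kadec_expands_if_spectrum[OF _ _ \<gamma>])
      show "continuous_on UNIV (\<lambda>t. Y n (T t v))"
        using sc by (intro bounded_linear.continuous_on[OF Yl]) (simp add: strongly_continuous_def)
      show "norm (Y n (T t v)) \<le> norm v * C" for t
        using C[of "T t v"] iso by (simp add: isometric_def)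
      fix \<xi> :: real assume "\<bar>\<xi>\<bar> > \<gamma>"
      then have "\<xi> \<notin> Beurling_spectrum T" using spec by (auto simp: subset_iff)
      then obtain f where f: "integrable lborel f" "\<And>v. L1_action T f v 0" "fourier f \<xi> \<noteq> 0"
        by (auto simp: Beurling_spectrum_def)
      have "fourier f \<xi> = (LINT t|lborel. f t * cis (- (\<xi> * t)))"
        unfolding fourier_def cis_conv_exp by (simp add: mult.commute)
      then show "\<exists>f. integrable lborel f \<and> (\<forall>x. conv (\<lambda>t. Y n (T t v)) f x = 0) \<and>
          (LINT t|lborel. f t * cis (- (\<xi> * t))) \<noteq> 0"
        using f(1,3) conv_matrix_coefficient_eq_0[OF T Y f(2)] by auto
    qed
  qed
  show ?thesis
    unfolding kadec_expands_def
  proof (intro allI impI)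
    fix x s :: real assume s: "\<bar>s\<bar> * \<eta> \<le> pi / 4"
    define d h where "d = s * \<eta> / pi" and "h = pi / \<eta>"
    define U where "U t = T t v" for t
    have d: "\<bar>d\<bar> \<le> 1/4"
      using s \<gamma> by (simp add: d_def abs_mult divide_le_eq)
    have tw: "norm (kadec_term d h U x k) \<le> (\<bar>kadec_cos d k\<bar> + \<bar>kadec_sin d k\<bar>) * norm v" for k
      using iso by (intro norm_kadec_term_le) (simp add: isometric_def U_def)
    have "summable (\<lambda>k. (\<bar>kadec_cos d k\<bar> + \<bar>kadec_sin d k\<bar>) * norm v)"
      by (intro summable_mult2 sums_summable[OF sums_kadec_abs[OF d]])
    from summable_comparison_test'[OF this tw] obtain L where L: "kadec_term d h U x sums L"
      by (auto simp: summable_def)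
    have "Y n (L - (U (x + s) - U x)) = 0" for n
    proof -
      have "(\<lambda>k. Y n (kadec_term d h U x k)) sums Y n L"
        by (rule bounded_linear.sums[OF Yl L])
      moreover have "(\<lambda>k. Y n (kadec_term d h U x k)) = kadec_term d h (\<lambda>t. Y n (U t)) x"
        by (intro ext kadec_term_linear[symmetric] bounded_linear.linear[OF Yl])
      moreover have "kadec_term d h (\<lambda>t. Y n (U t)) x sums (Y n (U (x + s)) - Y n (U x))"
        using exY[of n] s by (simp add: kadec_expands_def d_def h_def U_def)
      ultimately have "Y n L = Y n (U (x + s)) - Y n (U x)"
        by (simp only:) (rule sums_unique2)
      then show ?thesis
        by (simp add: linear_diff[OF bounded_linear.linear[OF Yl]])
    qed
    then have "L = U (x + s) - U x" using sep[of "L - (U (x + s) - U x)"] by simp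
    then show "kadec_term (s * \<eta> / pi) (pi / \<eta>) (\<lambda>t. T t v) x sums (T (x + s) v - T x v)"
      using L by (simp add: d_def h_def U_def[abs_def])
  qed
qed

lemma norm_sum_orbit_diff_le:
  fixes T :: "real \<Rightarrow> 'a::complex_banach \<Rightarrow> 'a" and g g' :: "int \<Rightarrow> real"
  assumes T: "line_representation T" and iso: "isometric T"
    and ex: "kadec_expands \<eta> (\<lambda>t. T t x)" and \<eta>: "\<eta> > 0"
    and p: "p \<ge> 1" and X: "synthesis_bounded p (\<lambda>n. T (g n) x)"
    and \<delta>: "\<And>n. \<bar>g' n - g n\<bar> \<le> \<delta>" "\<delta> * \<eta> \<le> pi / 4" and F: "finite F"
  shows "norm (\<Sum>n\<in>F. a n *\<^sub>C (T (g' n) x - T (g n) x))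
    \<le> synthesis_norm p (\<lambda>n. T (g n) x) * (1 - cos (\<delta> * \<eta>) + sin (\<delta> * \<eta>)) * fin_lp_norm p F a"
proof -
  define K where "K = synthesis_norm p (\<lambda>n. T (g n) x)"
  have K0: "K \<ge> 0" unfolding K_def by (rule synthesis_norm_nonneg[OF p X])
  have Tl: "linear (T t)" and Tc: "T t (c *\<^sub>C w) = c *\<^sub>C T t w"
    and Tadd: "T (s + t) w = T s (T t w)" for s t c w
    using T by (auto simp: line_representation_def bounded_clinear_def intro: bounded_linear.linear)
  have Tn: "norm (T t w) = norm w" for t w using iso by (simp add: isometric_def)
  define h where "h = pi / \<eta>"
  define d where "d n = (g' n - g n) * \<eta> / pi" for n
  define D where "D = \<delta> * \<eta> / pi"
  have \<delta>0: "\<delta> \<ge> 0" using \<delta>(1)[of 0] by linarith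
  have D: "D \<le> 1/4" "D \<ge> 0" using \<delta>(2) \<delta>0 \<eta> by (simp_all add: D_def divide_le_eq)
  have dD: "\<bar>d n\<bar> \<le> D" for n
    using mult_right_mono[OF \<delta>(1)[of n], of \<eta>] \<eta> by (simp add: d_def D_def abs_mult divide_right_mono)
  have s1: "kadec_term (d n) h (\<lambda>t. T t x) (g n) sums (T (g' n) x - T (g n) x)" for n
  proof -
    have "\<bar>g' n - g n\<bar> * \<eta> \<le> \<delta> * \<eta>" using \<delta>(1)[of n] \<eta> by (intro mult_right_mono) auto
    then have "\<bar>g' n - g n\<bar> * \<eta> \<le> pi / 4" using \<delta>(2) by linarith
    with ex have "kadec_term ((g' n - g n) * \<eta> / pi) (pi / \<eta>) (\<lambda>t. T t x) (g n)
        sums (T (g n + (g' n - g n)) x - T (g n) x)"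
      unfolding kadec_expands_def by blast
    then show ?thesis by (simp add: d_def h_def)
  qed
  have S: "(\<lambda>k. \<Sum>n\<in>F. a n *\<^sub>C kadec_term (d n) h (\<lambda>t. T t x) (g n) k)
      sums (\<Sum>n\<in>F. a n *\<^sub>C (T (g' n) x - T (g n) x))"
    by (intro sums_sum bounded_linear.sums[OF bounded_linear_scaleC] s1)
  have bound: "norm (\<Sum>n\<in>F. a n *\<^sub>C kadec_term (d n) h (\<lambda>t. T t x) (g n) k)
      \<le> (\<bar>kadec_cos D k\<bar> + \<bar>kadec_sin D k\<bar>) * (K * fin_lp_norm p F a)" for k
  proof -
    \<comment> \<open>Factors depending on n go into the sequences b and b', while the translations
      depend on k alone. The translations therefore leave the sum over n as isometries, and the
      synthesis bound applies to b and b'.\<close>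
    define b where "b n = of_real (kadec_cos (d n) k) * a n" for n
    define b' where "b' n = of_real (kadec_sin (d n) k) * a n" for n
    define V where "V = (\<Sum>n\<in>F. b n *\<^sub>C T (g n) x)"
    define V' where "V' = (\<Sum>n\<in>F. b' n *\<^sub>C T (g n) x)"
    define m where "m = (real k + 1/2) * h"
    have half: "a n *\<^sub>C ((r / 2) *\<^sub>R w) = (1/2) *\<^sub>R ((of_real r * a n) *\<^sub>C w)" for n r w
      unfolding scaleC_of_real[symmetric] scaleC_scaleC by (simp add: mult.commute)
    have sh: "T (g n + t) x = T t (T (g n) x)" "T (g n - t) x = T (- t) (T (g n) x)" for n t
      using Tadd[of t "g n" x] Tadd[of "- t" "g n" x] by (simp_all add: add.commute)
    have "a n *\<^sub>C kadec_term (d n) h (\<lambda>t. T t x) (g n) k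
      = (1/2) *\<^sub>R (T (real k * h) (b n *\<^sub>C T (g n) x) + T (- (real k * h)) (b n *\<^sub>C T (g n) x))
      + (1/2) *\<^sub>R (T m (b' n *\<^sub>C T (g n) x) - T (- m) (b' n *\<^sub>C T (g n) x))" for n
      unfolding kadec_term_def scaleC_add_right half b_def[symmetric] b'_def[symmetric] m_def[symmetric] sh Tc
      by (simp add: scaleC_add_right scaleC_diff_right)
    then have "(\<Sum>n\<in>F. a n *\<^sub>C kadec_term (d n) h (\<lambda>t. T t x) (g n) k)
      = (1/2) *\<^sub>R (T (real k * h) V + T (- (real k * h)) V) + (1/2) *\<^sub>R (T m V' - T (- m) V')"
      unfolding V_def V'_def
      by (simp add: sum.distrib sum_subtractf scaleR_sum_right[symmetric] linear_sum[OF Tl])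
    also have "norm \<dots> \<le> norm ((1/2) *\<^sub>R (T (real k * h) V + T (- (real k * h)) V))
        + norm ((1/2) *\<^sub>R (T m V' - T (- m) V'))"
      by (rule norm_triangle_ineq)
    also have "\<dots> \<le> norm V + norm V'"
      using norm_triangle_ineq[of "T (real k * h) V" "T (- (real k * h)) V"]
        norm_triangle_ineq4[of "T m V'" "T (- m) V'"] by (simp add: Tn)
    finally have le: "norm (\<Sum>n\<in>F. a n *\<^sub>C kadec_term (d n) h (\<lambda>t. T t x) (g n) k) \<le> norm V + norm V'" .
    have "norm V \<le> K * fin_lp_norm p F b"
      unfolding V_def K_def by (rule norm_sum_scaleC_le_synthesis_norm[OF p X F])
    moreover have "fin_lp_norm p F b \<le> \<bar>kadec_cos D k\<bar> * fin_lp_norm p F a"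
      by (rule fin_lp_norm_scale_le[OF p])
        (auto simp: b_def norm_mult intro!: mult_right_mono kadec_abs_mono dD D)
    moreover have "norm V' \<le> K * fin_lp_norm p F b'"
      unfolding V'_def K_def by (rule norm_sum_scaleC_le_synthesis_norm[OF p X F])
    moreover have "fin_lp_norm p F b' \<le> \<bar>kadec_sin D k\<bar> * fin_lp_norm p F a"
      by (rule fin_lp_norm_scale_le[OF p])
        (auto simp: b'_def norm_mult intro!: mult_right_mono kadec_abs_mono dD D)
    ultimately have "norm V \<le> K * (\<bar>kadec_cos D k\<bar> * fin_lp_norm p F a)"
      "norm V' \<le> K * (\<bar>kadec_sin D k\<bar> * fin_lp_norm p F a)"
      using mult_left_mono[OF _ K0] order_trans by blast+
    then show ?thesis
      using le by (simp add: algebra_simps)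
  qed
  have "(\<lambda>k. (\<bar>kadec_cos D k\<bar> + \<bar>kadec_sin D k\<bar>) * (K * fin_lp_norm p F a))
      sums ((1 - cos (pi * D) + sin (pi * \<bar>D\<bar>)) * (K * fin_lp_norm p F a))"
    using D by (intro sums_mult2 sums_kadec_abs) auto
  from norm_sums_le[OF S this bound]
  have "norm (\<Sum>n\<in>F. a n *\<^sub>C (T (g' n) x - T (g n) x))
      \<le> (1 - cos (pi * D) + sin (pi * \<bar>D\<bar>)) * (K * fin_lp_norm p F a)" .
  moreover have "pi * \<bar>D\<bar> = pi * D" using D(2) by simp
  moreover have "pi * D = \<delta> * \<eta>" by (simp add: D_def)
  ultimately show ?thesis by (simp add: K_def mult_ac)
qed

text \<open>The origin of the arcsin: cos \<theta> - sin \<theta> = sqrt 2 sin (pi/4 - \<theta>), so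
  the condition is b (1 - cos \<theta> + sin \<theta>) < 1 solved for \<theta>. The bound b >= 1
  puts the argument in [0, 1], so the arcsin is nonnegative and \<theta> < pi/4.\<close>

lemma small_if_arcsin_condition:
  assumes \<theta>: "0 \<le> \<theta>" and b: "b \<ge> 1"
    and less: "\<theta> < pi / 4 - arcsin (1 / sqrt 2 * (1 - 1 / b))"
  shows "\<theta> < pi / 4" "b * (1 - cos \<theta> + sin \<theta>) < 1"
proof -
  have sqrt2: "sqrt 2 / 2 = 1 / sqrt (2::real)" by (simp add: field_simps)
  define y where "y = 1 / sqrt 2 * (1 - 1 / b)"
  have y: "0 \<le> y" "y \<le> 1"
  proof -
    show "0 \<le> y" using b by (simp add: y_def)
    have "1 / sqrt 2 * (1 - 1 / b) \<le> 1 * 1" using b by (intro mult_mono) auto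
    then show "y \<le> 1" by (simp add: y_def)
  qed
  have as: "arcsin y \<ge> 0" using y arcsin_le_arcsin[of 0 y] by simp
  show lt: "\<theta> < pi / 4" using less as unfolding y_def[symmetric] by linarith
  have "sin (arcsin y) < sin (pi / 4 - \<theta>)"
    using less \<theta> as pi_gt_zero unfolding y_def[symmetric] by (intro sin_monotone_2pi) linarith+
  then have "y < sin (pi / 4 - \<theta>)" using y by simp
  also have "\<dots> = 1 / sqrt 2 * (cos \<theta> - sin \<theta>)"
    unfolding sin_diff sin_45 cos_45 sqrt2 by (simp add: algebra_simps diff_divide_distrib)
  finally have "1 / sqrt 2 * (1 - 1 / b) < 1 / sqrt 2 * (cos \<theta> - sin \<theta>)"
    unfolding y_def .
  then have "1 - 1 / b < cos \<theta> - sin \<theta>"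
    by (rule mult_left_less_imp_less) simp
  then have "1 - cos \<theta> + sin \<theta> < 1 / b" by linarith
  then show "b * (1 - cos \<theta> + sin \<theta>) < 1"
    using b by (simp add: pos_less_divide_eq mult.commute)
qed

text \<open>Synthesis after analysis is the identity, so a nonzero v can be cancelled from the
  resulting norm inequality. The alternative accounts for the zero space.\<close>

lemma synthesis_norm_lower_bound:
  fixes X :: "int \<Rightarrow> 'a::complex_banach"
  assumes p: "p \<ge> 1" and B: "B > 0" and XY: "atomic_decomposition p Y X A B" and X: "synthesis_bounded p X"
  shows "B * synthesis_norm p X \<ge> 1 \<or> synthesis_norm p X = 0"
proof (cases "\<exists>v::'a. v \<noteq> 0")
  case True
  then obtain v :: 'a where v: "v \<noteq> 0" by blast
  have Y: "(\<lambda>n. Y n v) \<in> lp p" "lp_norm p (\<lambda>n. Y n v) \<le> B * norm v" "int_sums (\<lambda>n. Y n v *\<^sub>C X n) v"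
    using XY by (auto simp: atomic_decomposition_def)
  have "norm v \<le> synthesis_norm p X * lp_norm p (\<lambda>n. Y n v)"
    using norm_synthesis_le[OF p X Y(1)] synthesis_eq[OF Y(3)] by simp
  also have "\<dots> \<le> synthesis_norm p X * (B * norm v)"
    by (intro mult_left_mono Y synthesis_norm_nonneg[OF p X])
  finally show ?thesis using v by (simp add: mult_ac)
next
  case False
  then have z: "norm (w::'a) = 0" for w by simp
  have "(\<lambda>n. 0) \<in> {c \<in> lp p. lp_norm p c \<le> 1}"
    using finite_support_in_lp[where F="{}" and c="\<lambda>n. 0" and p=p]
      lp_norm_finite_support[where F="{}" and c="\<lambda>n. 0" and p=p]
    by (simp add: fin_lp_norm_def)
  then have "synthesis_norm p X = 0"
    unfolding synthesis_norm_def z by (intro cSUP_const) blast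
  then show ?thesis by simp
qed

theorem theorem4p2:
  fixes T :: "real \<Rightarrow> 'a::complex_banach \<Rightarrow> 'a"
    and x :: 'a
    and Y :: "int \<Rightarrow> 'a \<Rightarrow> complex"
    and g g' :: "int \<Rightarrow> real"
    and \<gamma> \<delta> p A B :: real
  assumes "line_representation T" and "isometric T" and "strongly_continuous T"
    and "\<gamma> > 0" and "Beurling_spectrum T \<subseteq> {-\<gamma>..\<gamma>}"
    and "p \<ge> 1" and "A > 0" and "B \<ge> A"
    and "atomic_decomposition p Y (\<lambda>n. T (g n) x) A B"
    and "synthesis_bounded p (\<lambda>n. T (g n) x)"
    and "bdd_above (range (\<lambda>n. \<bar>g' n - g n\<bar>))"
    and "\<delta> = (SUP n. \<bar>g' n - g n\<bar>)"
    and "\<delta> < pi / (4 * \<gamma>) - 1 / \<gamma> *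
           arcsin (1 / sqrt 2 * (1 - 1 / (B * synthesis_norm p (\<lambda>n. T (g n) x))))"
  shows "(\<exists>Z. atomic_decomposition p Z (\<lambda>n. T (g' n) x)
            (A * inverse (1 + B * synthesis_norm p (\<lambda>n. T (g n) x)
                               * (1 - cos (\<delta> * \<gamma>) + sin (\<delta> * \<gamma>))))
            (B * inverse (1 - B * synthesis_norm p (\<lambda>n. T (g n) x)
                               * (1 - cos (\<delta> * \<gamma>) + sin (\<delta> * \<gamma>))))) \<and>
         (schauder_basis (\<lambda>n. T (g n) x) \<longrightarrow> schauder_basis (\<lambda>n. T (g' n) x))"
proof -
  let ?X = "\<lambda>n. T (g n) x" and ?W = "\<lambda>n. T (g' n) x"
  define K where "K = synthesis_norm p ?X"
  define q where "q = 1 - cos (\<delta> * \<gamma>) + sin (\<delta> * \<gamma>)"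
  note p = \<open>p \<ge> 1\<close> and X = \<open>synthesis_bounded p ?X\<close> and XY = \<open>atomic_decomposition p Y ?X A B\<close>
  have B: "B > 0" using \<open>A > 0\<close> \<open>B \<ge> A\<close> by linarith
  have K0: "K \<ge> 0" unfolding K_def by (rule synthesis_norm_nonneg[OF p X])
  have \<delta>: "\<bar>g' n - g n\<bar> \<le> \<delta>" for n
    unfolding assms(12) by (rule cSUP_upper[OF UNIV_I assms(11)])
  have \<delta>0: "\<delta> \<ge> 0" using \<delta>[of 0] by linarith
  have \<theta>0: "0 \<le> \<delta> * \<gamma>" using \<delta>0 \<open>\<gamma> > 0\<close> by simp
  have cond: "\<delta> * \<gamma> < pi / 4 - arcsin (1 / sqrt 2 * (1 - 1 / (B * K)))"
    using mult_strict_right_mono[OF assms(13) \<open>\<gamma> > 0\<close>] \<open>\<gamma> > 0\<close>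
    by (simp add: K_def left_diff_distrib)
  have "sin (pi / 4) = 1 / sqrt 2" unfolding sin_45 by (simp add: field_simps)
  then have as: "arcsin (1 / sqrt 2) = pi / 4"
    using arcsin_sin[of "pi / 4"] by simp
  \<comment> \<open>If K = 0, the quotient 1 / (B K) is 0 by the convention on division, and the
    hypothesis reads \<delta> \<gamma> < pi/4 - arcsin (1 / sqrt 2) = 0, which is impossible. This
    excludes the zero space.\<close>
  have "K \<noteq> 0"
  proof
    assume "K = 0"
    then have "\<delta> * \<gamma> < pi / 4 - arcsin (1 / sqrt 2)" using cond by simp
    then show False using \<theta>0 as by linarith
  qed
  then have BK: "B * K \<ge> 1"
    using synthesis_norm_lower_bound[OF p B XY X] by (simp add: K_def)
  note small = small_if_arcsin_condition[OF \<theta>0 BK cond]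
  have "q \<ge> 0" unfolding q_def
    using \<theta>0 small(1) sin_ge_zero[of "\<delta> * \<gamma>"] cos_le_one[of "\<delta> * \<gamma>"] by linarith
  have Ycl: "bounded_clinear (Y n)" for n using XY by (simp add: atomic_decomposition_def)
  have sep: "v = 0" if "\<And>n. Y n v = 0" for v
  proof -
    have "int_sums (\<lambda>n. Y n v *\<^sub>C ?X n) v" using XY by (simp add: atomic_decomposition_def)
    moreover have "int_sums (\<lambda>n. Y n v *\<^sub>C ?X n) 0"
      using int_sums_finite[of "{}" "\<lambda>n. Y n v *\<^sub>C ?X n"] that by simp
    ultimately show ?thesis by (rule int_sums_unique)
  qed
  have le: "norm (\<Sum>n\<in>F. c n *\<^sub>C (?W n - ?X n)) \<le> K * q * fin_lp_norm p F c" if F: "finite F" for F c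
  proof (rule tendsto_lowerbound)
    show "((\<lambda>\<eta>. K * (1 - cos (\<delta> * \<eta>) + sin (\<delta> * \<eta>)) * fin_lp_norm p F c)
        \<longlongrightarrow> K * q * fin_lp_norm p F c) (at_right \<gamma>)"
      unfolding q_def by (intro tendsto_intros)
    \<comment> \<open>The expansion is at hand only for \<eta> > \<gamma>. Since \<delta> \<gamma> <
      pi/4 is strict, it can be used for all \<eta> slightly above \<gamma>, and the estimate passes
      to the limit.\<close>
    have "((\<lambda>\<eta>. \<delta> * \<eta>) \<longlongrightarrow> \<delta> * \<gamma>) (at_right \<gamma>)" by (intro tendsto_intros)
    from order_tendstoD(2)[OF this small(1)] eventually_at_right_less
    show "\<forall>\<^sub>F \<eta> in at_right \<gamma>. norm (\<Sum>n\<in>F. c n *\<^sub>C (?W n - ?X n))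
        \<le> K * (1 - cos (\<delta> * \<eta>) + sin (\<delta> * \<eta>)) * fin_lp_norm p F c"
    proof eventually_elim
      case (elim \<eta>)
      have "kadec_expands \<eta> (\<lambda>t. T t x)"
        by (rule kadec_expands_orbit[OF assms(1-3,5) \<open>\<gamma> > 0\<close> elim(2) Ycl sep])
      then show ?case
        unfolding K_def using elim \<open>\<gamma> > 0\<close>
        by (intro norm_sum_orbit_diff_le[OF assms(1,2) _ _ p X \<delta> _ F]) auto
    qed
  qed simp
  have "0 \<le> K * q" using K0 \<open>q \<ge> 0\<close> by simp
  moreover have "B * (K * q) < 1" using small(2) by (simp only: q_def mult.assoc)
  ultimately show ?thesis
    using atomic_decomposition_perturbation[OF p \<open>A > 0\<close> \<open>B \<ge> A\<close> XY _ _ le]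
    unfolding K_def q_def mult.assoc by blast
qed

end
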